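(* Let $(\mathcal A,\varphi,\psi,\theta)$ be a unital 3-algebraic probability space, $a\in\mathcal A$, let $(\lambda,\mu,\nu)$ be the distribution of $a$, let $\{(\lambda_t,\mu_t,\nu_t)\}_{t\in\mathbb R}$ be the one-parameter $\alpha$-free convolution group associated with $(\lambda,\mu,\nu)$, and let $A_\lambda(z)=\frac{\partial}{\partial t}\big|_{t=0}F_{\lambda_t}(z)$, $B_\mu(z)=\frac{\partial}{\partial t}\big|_{t=0}F_{\mu_t}(z)$, $C_\nu(z)=\frac{\partial}{\partial t}\big|_{t=0}F_{\nu_t}(z)$. Then the following differential equations hold (as identities of formal Laurent series): $$\frac{\partial F_{\lambda_t}}{\partial t}=A_\lambda\circ F_{\mu_t}+(C_\nu\circ F_{\mu_t})\cdot\Big[\frac{\partial F_{\lambda_t}}{\partial z}-1\Big],$$ $$\frac{\partial F_{\lambda_t}}{\partial t}=A_\lambda\circ F_{\nu_t}+(B_\mu\circ F_{\nu_t})\cdot\Big[\frac{\partial F_{\lambda_t}}{\partial z}-1\Big],$$ $$\frac{\partial F_{\lambda_t}}{\partial t}=\frac{(B_\mu\circ F_{\nu_t})\cdot(A_\lambda\circ F_{\mu_t})-(A_\lambda\circ F_{\nu_t})\cdot(C_\nu\circ F_{\mu_t})}{B_\mu\circ F_{\nu_t}-C_\nu\circ F_{\mu_t}},$$ where the last equation is asserted only when the denominator $B_\mu\circ F_{\nu_t}-C_\nu\circ F_{\mu_t}$ is nonzero.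
   Context: Algebras are over $\mathbb C$. A unital 3-algebraic probability space is a unital algebra with three unital linear functionals. A distribution is a unital linear functional on $\mathbb C[x]$. The distribution of $a$ is the triplet $(\lambda,\mu,\nu)$ with $\lambda(x^n)=\varphi(a^n)$, $\mu(x^n)=\psi(a^n)$, $\nu(x^n)=\theta(a^n)$. For a distribution $\mu$, $G_\mu(z)=\sum_{n\ge0}\mu(x^n)z^{-n-1}$ and $F_\mu(z)=1/G_\mu(z)=z-b_1-b_2z^{-1}-\cdots$, as formal Laurent series (in $z^{-1}$). Derivatives in $t$ are taken coefficientwise; composition $f\circ F$ of a series $f(z)=\sum_{n\ge0}c_nz^{-n}$ with $F(z)=z+O(1)$ is formal. **$\alpha$-free product.** For a totally ordered set $I$, $I^\ast$ is the set of finite sequences $\mathbf i=(i_1,\dots,i_n)$, $n\ge1$, in $I$ with $i_k\ne i_{k+1}$. $\mathrm{Peak}(\mathbf i)=\{k\in\{2,\dots,n-1\}: i_{k-1}<i_k>i_{k+1}\}$, $\mathrm{Bot}(\mathbf i)=\{k\in\{2,\dots,n-1\}: i_{k-1}>i_k<i_{k+1}\}$. Given unital 3-algebraic probability spaces $(\mathcal A_i,\varphi_i,\psi_i,\theta_i)$, define linear functionals on $\mathcal A_{i_k}$: $\alpha_{\mathbf i,1}=\varphi_{i_1}$, $\alpha_{\mathbf i,k}=\psi_{i_k}$ if $k\in\mathrm{Peak}(\mathbf i)$, $\theta_{i_k}$ if $k\in\mathrm{Bot}(\mathbf i)$, $0$ otherwise; $\beta_{\mathbf i,k}$ (resp. $\gamma_{\mathbf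 i,k}$) is the same with $\varphi_{i_1}$ replaced by $\psi_{i_1}$ (resp. $\theta_{i_1}$). The $\alpha$-free product is the unital free product $\mathcal U=\ast_{i\in I}\mathcal A_i$ with the unique unital linear functionals $\widetilde\varphi,\widetilde\psi,\widetilde\theta$ such that for every $\mathbf i\in I^\ast$, $a_k\in\mathcal A_{i_k}$: $\widetilde\varphi(a_1\cdots a_n)=0$ if all $a_k\in\ker\alpha_{\mathbf i,k}$; $\widetilde\psi(a_1\cdots a_n)=0$ if all $a_k\in\ker\beta_{\mathbf i,k}$; $\widetilde\theta(a_1\cdots a_n)=0$ if all $a_k\in\ker\gamma_{\mathbf i,k}$. **One-parameter group.** Take the $\alpha$-free product $(\mathcal U,\widetilde\varphi,\widetilde\psi,\widetilde\theta)$ over $\mathbb N=\{1,2,\dots\}$ of copies of $(\mathcal A,\varphi,\psi,\theta)$, let $a^{(j)}$ be the $j$-th copy of $a$, $N.a=a^{(1)}+\cdots+a^{(N)}$ and $0.a=0$. For $N\in\{0\}\cup\mathbb N$ let $\lambda_N(x^n)=\widetilde\varphi((N.a)^n)$, $\mu_N(x^n)=\widetilde\psi((N.a)^n)$, $\nu_N(x^n)=\widetilde\theta((N.a)^n)$. For $n\ge1$ these are polynomials in $N$ without constant term; replacing $N$ by a real number $t$ in these polynomials defines distributions $\lambda_t,\mu_t,\nu_t$ for $t\in\mathbb R$. *)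

theory Defs
  imports
    "HOL-Analysis.Analysis"
    "HOL-Computational_Algebra.Computational_Algebra"
begin

section \<open>Unital complex algebras and unital functionals\<close>

text \<open>The axiom \<open>0 \<noteq> 1\<close> of \<^class>\<open>ring_1\<close> is no restriction here: it holds in every
  unital algebra that carries a unital linear functional.\<close>

class complex_algebra_1 = ring_1 +
  fixes scaleC :: "complex \<Rightarrow> 'a \<Rightarrow> 'a"  (infixr \<open>*\<^sub>C\<close> 75)
  assumes scaleC_add_right: "c *\<^sub>C (x + y) = c *\<^sub>C x + c *\<^sub>C y"
    and scaleC_add_left: "(c + d) *\<^sub>C x = c *\<^sub>C x + d *\<^sub>C x"
    and scaleC_scaleC: "c *\<^sub>C d *\<^sub>C x = (c * d) *\<^sub>C x"
    and scaleC_one: "1 *\<^sub>C x = x"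
    and mult_scaleC_left: "(c *\<^sub>C x) * y = c *\<^sub>C (x * y)"
    and mult_scaleC_right: "x * (c *\<^sub>C y) = c *\<^sub>C (x * y)"

lemma vector_space_scaleC: "vector_space (scaleC :: complex \<Rightarrow> 'a \<Rightarrow> 'a::complex_algebra_1)"
  by unfold_locales (simp_all add: scaleC_add_right scaleC_add_left scaleC_scaleC scaleC_one)

definition unital_functional :: "('a::complex_algebra_1 \<Rightarrow> complex) \<Rightarrow> bool" where
  "unital_functional f \<longleftrightarrow> Vector_Spaces.linear scaleC (*) f \<and> f 1 = 1"

definition unital_hom :: "('a::complex_algebra_1 \<Rightarrow> 'b::complex_algebra_1) \<Rightarrow> bool" where
  "unital_hom h \<longleftrightarrow>
     Vector_Spaces.linear scaleC scaleC h \<and> h 1 = 1 \<and> (\<forall>x y. h (x * y) = h x * h y)"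

definition three_probability_space ::
  "('a::complex_algebra_1 \<Rightarrow> complex) \<Rightarrow> ('a \<Rightarrow> complex) \<Rightarrow> ('a \<Rightarrow> complex) \<Rightarrow> bool" where
  "three_probability_space \<phi> \<psi> \<theta> \<longleftrightarrow>
     unital_functional \<phi> \<and> unital_functional \<psi> \<and> unital_functional \<theta>"


section \<open>The unital free product of copies of an algebra\<close>

text \<open>The unital free product of copies of \<open>'a\<close> indexed by \<open>'i\<close>, i.e. the coproduct in the category
  of unital algebras, presented by generators and relations: formal algebra expressions in the
  symbols \<open>Gen i a\<close> modulo the smallest congruence that makes the quotient a unital algebra and each
  \<open>Gen i\<close> a unital homomorphism. The universal property is proved below.\<close>

datatype ('i, 'a) fp_term =
    Zero
  | One
  | Gen 'i 'a
  | Add "('i, 'a) fp_term" "('i, 'a) fp_term"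
  | Mul "('i, 'a) fp_term" "('i, 'a) fp_term"
  | Scale complex "('i, 'a) fp_term"

inductive fp_cong :: "('i, 'a::complex_algebra_1) fp_term \<Rightarrow> ('i, 'a) fp_term \<Rightarrow> bool" where
  fp_refl: "fp_cong x x"
| fp_sym: "fp_cong x y \<Longrightarrow> fp_cong y x"
| fp_trans: "fp_cong x y \<Longrightarrow> fp_cong y z \<Longrightarrow> fp_cong x z"
| fp_Add: "fp_cong x x' \<Longrightarrow> fp_cong y y' \<Longrightarrow> fp_cong (Add x y) (Add x' y')"
| fp_Mul: "fp_cong x x' \<Longrightarrow> fp_cong y y' \<Longrightarrow> fp_cong (Mul x y) (Mul x' y')"
| fp_Scale: "fp_cong x x' \<Longrightarrow> fp_cong (Scale c x) (Scale c x')"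
| fp_add_assoc: "fp_cong (Add (Add x y) z) (Add x (Add y z))"
| fp_add_commute: "fp_cong (Add x y) (Add y x)"
| fp_add_zero: "fp_cong (Add Zero x) x"
| fp_add_neg: "fp_cong (Add (Scale (-1) x) x) Zero"
| fp_mul_assoc: "fp_cong (Mul (Mul x y) z) (Mul x (Mul y z))"
| fp_one_left: "fp_cong (Mul One x) x"
| fp_one_right: "fp_cong (Mul x One) x"
| fp_distrib_right: "fp_cong (Mul (Add x y) z) (Add (Mul x z) (Mul y z))"
| fp_distrib_left: "fp_cong (Mul x (Add y z)) (Add (Mul x y) (Mul x z))"
| fp_scale_add_right: "fp_cong (Scale c (Add x y)) (Add (Scale c x) (Scale c y))"
| fp_scale_add_left: "fp_cong (Scale (c + d) x) (Add (Scale c x) (Scale d x))"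
| fp_scale_scale: "fp_cong (Scale c (Scale d x)) (Scale (c * d) x)"
| fp_scale_one: "fp_cong (Scale 1 x) x"
| fp_mul_scale_left: "fp_cong (Mul (Scale c x) y) (Scale c (Mul x y))"
| fp_mul_scale_right: "fp_cong (Mul x (Scale c y)) (Scale c (Mul x y))"
| fp_gen_add: "fp_cong (Gen i (a + b)) (Add (Gen i a) (Gen i b))"
| fp_gen_mul: "fp_cong (Gen i (a * b)) (Mul (Gen i a) (Gen i b))"
| fp_gen_scale: "fp_cong (Gen i (c *\<^sub>C a)) (Scale c (Gen i a))"
| fp_gen_one: "fp_cong (Gen i 1) One"

primrec fp_eval :: "('i \<Rightarrow> 'a \<Rightarrow> 'b::complex_algebra_1) \<Rightarrow> ('i, 'a) fp_term \<Rightarrow> 'b" where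
  "fp_eval f Zero = 0"
| "fp_eval f One = 1"
| "fp_eval f (Gen i a) = f i a"
| "fp_eval f (Add x y) = fp_eval f x + fp_eval f y"
| "fp_eval f (Mul x y) = fp_eval f x * fp_eval f y"
| "fp_eval f (Scale c x) = c *\<^sub>C fp_eval f x"

lemma unital_homD:
  assumes "unital_hom h"
  shows "h 1 = 1" "h (x + y) = h x + h y" "h (x * y) = h x * h y" "h (c *\<^sub>C x) = c *\<^sub>C h x"
proof -
  have "module_hom scaleC scaleC h"
    using assms by (simp add: unital_hom_def Vector_Spaces.linear_def)
  then show "h (x + y) = h x + h y" "h (c *\<^sub>C x) = c *\<^sub>C h x"
    by (rule module_hom.add, rule module_hom.scale)
qed (use assms in \<open>simp_all add: unital_hom_def\<close>)

lemma unital_homI: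
  assumes "\<And>x y. h (x + y) = h x + h y" "\<And>c x. h (c *\<^sub>C x) = c *\<^sub>C h x"
    and "h 1 = 1" "\<And>x y. h (x * y) = h x * h y"
  shows "unital_hom h"
proof -
  have "Vector_Spaces.linear scaleC scaleC h"
    by (intro Vector_Spaces.linear.intro vector_space_scaleC)
      (auto simp: module_hom_iff module_iff_vector_space vector_space_scaleC assms)
  then show ?thesis using assms by (simp add: unital_hom_def)
qed

lemma scaleC_minus_one: "((-1) *\<^sub>C x) + x = (0 :: 'a::complex_algebra_1)"
proof -
  have "((-1) *\<^sub>C x) + x = (-1 + 1) *\<^sub>C x"
    by (simp only: scaleC_add_left scaleC_one)
  also have "\<dots> = 0"
    using vector_space_scaleC[where 'a='a]
    by (simp add: module.scale_zero_left module_iff_vector_space)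
  finally show ?thesis .
qed

lemma fp_eval_cong:
  assumes "\<And>i. unital_hom (f i)" "fp_cong x y"
  shows "fp_eval f x = fp_eval f y"
  using assms(2)
proof induction
  case (fp_add_neg x)
  show ?case by (simp only: fp_eval.simps scaleC_minus_one)
qed (simp_all add: unital_homD[OF assms(1)] scaleC_add_right scaleC_add_left scaleC_scaleC
      scaleC_one mult_scaleC_left mult_scaleC_right algebra_simps)

quotient_type (overloaded) ('i, 'a) free_product =
  "('i, 'a::complex_algebra_1) fp_term" / fp_cong
  by (rule equivpI)
    (auto intro!: reflpI sympI transpI intro: fp_refl fp_sym fp_trans)

instantiation free_product :: (type, complex_algebra_1) complex_algebra_1
begin

lift_definition zero_free_product :: "('a, 'b) free_product" is Zero .
lift_definition one_free_product :: "('a, 'b) free_product" is One .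
lift_definition plus_free_product ::
  "('a, 'b) free_product \<Rightarrow> ('a, 'b) free_product \<Rightarrow> ('a, 'b) free_product" is Add
  by (rule fp_Add)
lift_definition times_free_product ::
  "('a, 'b) free_product \<Rightarrow> ('a, 'b) free_product \<Rightarrow> ('a, 'b) free_product" is Mul
  by (rule fp_Mul)
lift_definition scaleC_free_product ::
  "complex \<Rightarrow> ('a, 'b) free_product \<Rightarrow> ('a, 'b) free_product" is Scale
  by (rule fp_Scale)
lift_definition uminus_free_product :: "('a, 'b) free_product \<Rightarrow> ('a, 'b) free_product"
  is "Scale (-1)"
  by (rule fp_Scale)
definition minus_free_product ::
  "('a, 'b) free_product \<Rightarrow> ('a, 'b) free_product \<Rightarrow> ('a, 'b) free_product" where
  "minus_free_product x y = x + (- y)"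

instance
proof
  fix x y z :: "('a, 'b) free_product" and c d :: complex
  show "x + y + z = x + (y + z)" by transfer (rule fp_add_assoc)
  show "x + y = y + x" by transfer (rule fp_add_commute)
  show "0 + x = x" by transfer (rule fp_add_zero)
  show "- x + x = 0" by transfer (rule fp_add_neg)
  show "x - y = x + (- y)" by (rule minus_free_product_def)
  show "x * y * z = x * (y * z)" by transfer (rule fp_mul_assoc)
  show "1 * x = x" by transfer (rule fp_one_left)
  show "x * 1 = x" by transfer (rule fp_one_right)
  show "(x + y) * z = x * z + y * z" by transfer (rule fp_distrib_right)
  show "x * (y + z) = x * y + x * z" by transfer (rule fp_distrib_left)
  show "c *\<^sub>C (x + y) = c *\<^sub>C x + c *\<^sub>C y" by transfer (rule fp_scale_add_right)
  show "(c + d) *\<^sub>C x = c *\<^sub>C x + d *\<^sub>C x" by transfer (rule fp_scale_add_left)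
  show "c *\<^sub>C d *\<^sub>C x = (c * d) *\<^sub>C x" by transfer (rule fp_scale_scale)
  show "1 *\<^sub>C x = x" by transfer (rule fp_scale_one)
  show "(c *\<^sub>C x) * y = c *\<^sub>C (x * y)" by transfer (rule fp_mul_scale_left)
  show "x * (c *\<^sub>C y) = c *\<^sub>C (x * y)" by transfer (rule fp_mul_scale_right)
  have "unital_hom (\<lambda>a :: 'b. a)" by (rule unital_homI) simp_all
  then have "\<not> fp_cong (Zero :: ('a, 'b) fp_term) One"
    using fp_eval_cong[of "\<lambda>_ :: 'a. \<lambda>a :: 'b. a" Zero One] by auto
  then show "(0 :: ('a, 'b) free_product) \<noteq> 1" by transfer
qed

end

lift_definition fp_emb :: "'i \<Rightarrow> 'a::complex_algebra_1 \<Rightarrow> ('i, 'a) free_product" is Gen .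

lemma unital_hom_fp_emb:
  "unital_hom (fp_emb i :: 'a::complex_algebra_1 \<Rightarrow> ('i, 'a) free_product)"
proof (rule unital_homI)
  show "fp_emb i (x + y) = fp_emb i x + fp_emb i y" for x y :: 'a
    by transfer (rule fp_gen_add)
  show "fp_emb i (c *\<^sub>C x) = c *\<^sub>C fp_emb i x" for c and x :: 'a
    by transfer (rule fp_gen_scale)
  show "fp_emb i (1 :: 'a) = 1" by transfer (rule fp_gen_one)
  show "fp_emb i (x * y) = fp_emb i x * fp_emb i y" for x y :: 'a
    by transfer (rule fp_gen_mul)
qed

theorem free_product_universal:
  fixes f :: "'i \<Rightarrow> 'a::complex_algebra_1 \<Rightarrow> 'b::complex_algebra_1"
  assumes f: "\<And>i. unital_hom (f i)"
  shows "\<exists>!h :: ('i, 'a) free_product \<Rightarrow> 'b. unital_hom h \<and> (\<forall>i a. h (fp_emb i a) = f i a)"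
proof (rule ex1I)
  define h :: "('i, 'a) free_product \<Rightarrow> 'b" where "h x = fp_eval f (rep_free_product x)" for x
  have rep: "fp_cong (rep_free_product (abs_free_product x)) x" for x :: "('i, 'a) fp_term"
    using Quotient_free_product by (metis Quotient_rep_abs fp_refl)
  have h_abs: "h (abs_free_product x) = fp_eval f x" for x
    unfolding h_def by (rule fp_eval_cong[OF f rep])
  have abs: "\<exists>x'. x = abs_free_product x'" for x :: "('i, 'a) free_product"
    by (metis Quotient_abs_rep Quotient_free_product)
  have "unital_hom h"
  proof (rule unital_homI)
    show "h (x + y) = h x + h y" for x y
      using abs[of x] abs[of y] by (auto simp: plus_free_product.abs_eq h_abs)
    show "h (x * y) = h x * h y" for x y
      using abs[of x] abs[of y] by (auto simp: times_free_product.abs_eq h_abs)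
    show "h (c *\<^sub>C x) = c *\<^sub>C h x" for c x
      using abs[of x] by (auto simp: scaleC_free_product.abs_eq h_abs)
    show "h 1 = 1" by (simp add: one_free_product.abs_eq h_abs)
  qed
  moreover have "h (fp_emb i a) = f i a" for i a by (simp add: fp_emb.abs_eq h_abs)
  ultimately show "unital_hom h \<and> (\<forall>i a. h (fp_emb i a) = f i a)" by blast
  fix g :: "('i, 'a) free_product \<Rightarrow> 'b"
  assume g: "unital_hom g \<and> (\<forall>i a. g (fp_emb i a) = f i a)"
  note gD = unital_homD[OF conjunct1[OF g]]
  have g0: "g 0 = 0" using gD(2)[of 0 0] by simp
  have "g (abs_free_product x) = fp_eval f x" for x
    by (induction x)
      (simp_all add: gD g g0 fp_emb.abs_eq[symmetric] zero_free_product.abs_eq[symmetric]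
        one_free_product.abs_eq[symmetric] plus_free_product.abs_eq[symmetric]
        times_free_product.abs_eq[symmetric] scaleC_free_product.abs_eq[symmetric])
  then show "g = h" using abs h_abs by (metis ext)
qed


section \<open>The \<open>\<alpha>\<close>-free product\<close>

text \<open>Positions in an index sequence are counted from \<open>0\<close>.\<close>

definition peaks :: "'i::linorder list \<Rightarrow> nat set" where
  "peaks is = {k. 0 < k \<and> Suc k < length is \<and> is ! (k - 1) < is ! k \<and> is ! Suc k < is ! k}"

definition bottoms :: "'i::linorder list \<Rightarrow> nat set" where
  "bottoms is = {k. 0 < k \<and> Suc k < length is \<and> is ! k < is ! (k - 1) \<and> is ! k < is ! Suc k}"

text \<open>The functional attached to position \<open>k\<close>; the family \<open>\<xi>\<close> is used at the first position,
  so that \<open>\<xi> = \<phi>\<close>, \<open>\<psi>\<close>, \<open>\<theta>\<close> gives the three systems \<open>\<alpha>\<close>, \<open>\<beta>\<close>, \<open>\<gamma>\<close> of the definition.\<close>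

definition position_functional ::
  "('i::linorder \<Rightarrow> 'a \<Rightarrow> complex) \<Rightarrow> ('i \<Rightarrow> 'a \<Rightarrow> complex) \<Rightarrow> ('i \<Rightarrow> 'a \<Rightarrow> complex) \<Rightarrow>
    'i list \<Rightarrow> nat \<Rightarrow> 'a \<Rightarrow> complex" where
  "position_functional \<xi> \<psi> \<theta> is k a =
     (if k = 0 then \<xi> (is ! 0) a
      else if k \<in> peaks is then \<psi> (is ! k) a
      else if k \<in> bottoms is then \<theta> (is ! k) a
      else 0)"

definition vanishes_on_alternating ::
  "('i::linorder \<Rightarrow> 'a::complex_algebra_1 \<Rightarrow> complex) \<Rightarrow> ('i \<Rightarrow> 'a \<Rightarrow> complex) \<Rightarrow>
    ('i \<Rightarrow> 'a \<Rightarrow> complex) \<Rightarrow> (('i, 'a) free_product \<Rightarrow> complex) \<Rightarrow> bool" where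
  "vanishes_on_alternating \<xi> \<psi> \<theta> F \<longleftrightarrow>
     (\<forall>is as. is \<noteq> [] \<and> distinct_adj is \<and> length as = length is \<and>
        (\<forall>k < length is. position_functional \<xi> \<psi> \<theta> is k (as ! k) = 0) \<longrightarrow>
        F (prod_list (map2 fp_emb is as)) = 0)"

text \<open>\<open>(\<phi>', \<psi>', \<theta>')\<close> are the functionals of the \<open>\<alpha>\<close>-free product of the spaces
  \<open>('a, \<phi> i, \<psi> i, \<theta> i)\<close>; these conditions determine them uniquely.\<close>

definition alpha_free_product ::
  "('i::linorder \<Rightarrow> 'a::complex_algebra_1 \<Rightarrow> complex) \<Rightarrow> ('i \<Rightarrow> 'a \<Rightarrow> complex) \<Rightarrow>
    ('i \<Rightarrow> 'a \<Rightarrow> complex) \<Rightarrow> (('i, 'a) free_product \<Rightarrow> complex) \<Rightarrow>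
    (('i, 'a) free_product \<Rightarrow> complex) \<Rightarrow> (('i, 'a) free_product \<Rightarrow> complex) \<Rightarrow> bool" where
  "alpha_free_product \<phi> \<psi> \<theta> \<phi>' \<psi>' \<theta>' \<longleftrightarrow>
     three_probability_space \<phi>' \<psi>' \<theta>' \<and>
     vanishes_on_alternating \<phi> \<psi> \<theta> \<phi>' \<and>
     vanishes_on_alternating \<psi> \<psi> \<theta> \<psi>' \<and>
     vanishes_on_alternating \<theta> \<psi> \<theta> \<theta>'"


section \<open>Distributions and the one-parameter group\<close>

text \<open>A distribution is a unital linear functional on \<open>\<complex>[x]\<close>, here of type
  \<^typ>\<open>complex poly \<Rightarrow> complex\<close>; the next definition is the linear functional with prescribed
  moments.\<close>

definition functional_of_moments :: "(nat \<Rightarrow> complex) \<Rightarrow> complex poly \<Rightarrow> complex" where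
  "functional_of_moments m p = (\<Sum>i\<le>degree p. coeff p i * m i)"

lemma functional_of_moments_monom: "functional_of_moments m (monom 1 n) = m n"
proof -
  have "functional_of_moments m (monom 1 n) = (\<Sum>i\<le>n. if i = n then m i else 0)"
    unfolding functional_of_moments_def by (intro sum.cong) (auto simp: degree_monom_eq)
  then show ?thesis by simp
qed

definition distr_of :: "('a::complex_algebra_1 \<Rightarrow> complex) \<Rightarrow> 'a \<Rightarrow> complex poly \<Rightarrow> complex" where
  "distr_of f a = functional_of_moments (\<lambda>n. f (a ^ n))"

text \<open>The copies \<open>1, \<dots>, N\<close> of \<open>a\<close> carry the indices \<open>0, \<dots>, N - 1\<close>.\<close>

definition sum_of_copies :: "nat \<Rightarrow> 'a::complex_algebra_1 \<Rightarrow> (nat, 'a) free_product" where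
  "sum_of_copies N a = (\<Sum>j<N. fp_emb j a)"

text \<open>Each moment of \<open>D N\<close> is supposed to be a polynomial in \<open>N\<close>, into which the real number \<open>t\<close> is
  substituted.\<close>

definition interpolate ::
  "(nat \<Rightarrow> complex poly \<Rightarrow> complex) \<Rightarrow> real \<Rightarrow> complex poly \<Rightarrow> complex" where
  "interpolate D t = functional_of_moments
     (\<lambda>n. poly (THE q. \<forall>N. poly q (of_nat N) = D N (monom 1 n)) (of_real t))"

definition conv_group ::
  "((nat, 'a::complex_algebra_1) free_product \<Rightarrow> complex) \<Rightarrow> 'a \<Rightarrow> real \<Rightarrow>
    complex poly \<Rightarrow> complex" where
  "conv_group f a = interpolate (\<lambda>N. distr_of f (sum_of_copies N a))"


section \<open>Formal Laurent series in \<open>1/z\<close>\<close>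

text \<open>A series in \<open>z\<close> with finitely many positive powers of \<open>z\<close> is an element of
  \<^typ>\<open>complex fls\<close> whose variable \<^const>\<open>fls_X\<close> stands for \<open>1/z\<close>: the coefficient of
  \<open>z\<^sup>-\<^sup>n\<close> has index \<open>n\<close>.\<close>

definition G_transform :: "(complex poly \<Rightarrow> complex) \<Rightarrow> complex fls" where
  "G_transform \<mu> = fls_X * fps_to_fls (Abs_fps (\<lambda>n. \<mu> (monom 1 n)))"

definition F_transform :: "(complex poly \<Rightarrow> complex) \<Rightarrow> complex fls" where
  "F_transform \<mu> = 1 / G_transform \<mu>"

text \<open>With \<open>w = 1/z\<close>, \<open>d/dz = - w\<^sup>2 d/dw\<close>.\<close>

definition deriv_z :: "complex fls \<Rightarrow> complex fls" where
  "deriv_z f = - (fls_X ^ 2) * fls_deriv f"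

text \<open>If \<open>f(z) = \<Sum>n\<ge>0. c\<^sub>n z\<^sup>-\<^sup>n\<close> and \<open>F(z) = z + O(1)\<close>, then \<open>f \<circ> F\<close> is
  \<open>\<Sum>n\<ge>0. c\<^sub>n (1/F)\<^sup>n\<close>, where \<open>1/F\<close> is a power series in \<open>1/z\<close> without constant term; that is, in
  terms of the variable \<open>1/z\<close>, the series \<open>1/F\<close> is substituted into \<open>f\<close>.\<close>

definition compose_z :: "complex fls \<Rightarrow> complex fls \<Rightarrow> complex fls"  (infixl \<open>\<circ>\<^sub>z\<close> 75) where
  "f \<circ>\<^sub>z F = fls_compose_fps f (fls_regpart (1 / F))"

definition has_coeff_deriv :: "(real \<Rightarrow> complex fls) \<Rightarrow> complex fls \<Rightarrow> real \<Rightarrow> bool" where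
  "has_coeff_deriv F D t \<longleftrightarrow>
     (\<forall>n. ((\<lambda>s. fls_nth (F s) n) has_vector_derivative fls_nth D n) (at t))"

definition coeff_deriv :: "(real \<Rightarrow> complex fls) \<Rightarrow> real \<Rightarrow> complex fls" where
  "coeff_deriv F t = (THE D. has_coeff_deriv F D t)"

lemma has_coeff_deriv_imp_coeff_deriv:
  assumes "has_coeff_deriv F D t"
  shows "coeff_deriv F t = D"
  unfolding coeff_deriv_def
proof (rule the_equality[where P = "\<lambda>D. has_coeff_deriv F D t"])
  fix D' assume "has_coeff_deriv F D' t"
  with assms show "D' = D"
    unfolding has_coeff_deriv_def
    by (intro fls_eqI) (metis vector_derivative_at)
qed (rule assms)

end

theory Submission
  imports Defs
begin

text \<open>Split the copies of \<open>a\<close> into a left block with sum \<open>b\<close> and a right block with sum \<open>c\<close>. The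
  \<open>\<alpha>\<close>-free product is associative: alternating products of elements of the two blocks factorize
  under the three functionals as soon as the inner factors are centred, for \<open>\<theta>'\<close> in the left block and
  for \<open>\<psi>'\<close> in the right one. So moments of \<open>b + c\<close> are polynomials in those of \<open>b\<close> and \<open>c\<close>, which
  makes the moments of \<open>N.a\<close> polynomials in \<open>N\<close>. If \<open>b\<close> consists of \<open>M\<close> copies, then two powers of \<open>b\<close>
  separated by a centred power of \<open>c\<close> contribute only \<open>O(M\<^sup>2)\<close>. Modulo \<open>M\<^sup>2\<close> one may therefore
  replace every power of \<open>c\<close> between two factors \<open>b\<close> by its \<open>\<psi>'\<close>-moment, and only the moments of
  the words \<open>c\<^sup>i b\<^sup>l c\<^sup>j\<close> are left. Summing them up gives the derivative of the moment series of
  \<open>\<lambda>\<^sub>t\<close>, which is the first equation; exchanging the roles of the blocks gives the second one, and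
  eliminating \<open>\<partial>F/\<partial>z - 1\<close> the third.\<close>

section \<open>Centred words in the free product\<close>

interpretation cvs: vector_space "scaleC :: complex \<Rightarrow> 'a \<Rightarrow> 'a::complex_algebra_1"
  by (rule vector_space_scaleC)

lemma unital_functionalD:
  assumes "unital_functional f"
  shows "f 1 = 1" "f (x + y) = f x + f y" "f (c *\<^sub>C x) = c * f x" "f (x - y) = f x - f y"
    "f 0 = 0" "f (sum h A) = (\<Sum>i\<in>A. f (h i))"
proof -
  have 1: "module_hom scaleC (*) f"
    using assms by (simp add: unital_functional_def Vector_Spaces.linear_def)
  show "f (x + y) = f x + f y" "f (c *\<^sub>C x) = c * f x" "f (x - y) = f x - f y" "f 0 = 0"
    "f (sum h A) = (\<Sum>i\<in>A. f (h i))"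
    using module_hom.add[OF 1] module_hom.scale[OF 1] module_hom.diff[OF 1] module_hom.zero[OF 1]
      module_hom.sum[OF 1] by auto
  show "f 1 = 1" using assms by (simp add: unital_functional_def)
qed

lemma centred_functional:
  assumes "unital_functional f"
  shows "f (x - f x *\<^sub>C 1) = 0"
  by (simp add: unital_functionalD[OF assms])

lemma pair_list_cases [case_names Nil Cons]:
  obtains "w = []" | i x v where "w = (i, x) # v"
  by (cases w) auto

definition word :: "('i \<times> 'a::complex_algebra_1) list \<Rightarrow> ('i, 'a) free_product" where
  "word w = prod_list (map (\<lambda>(i, x). fp_emb i x) w)"

lemma word_simps [simp]:
  "word [] = 1" "word ((i, x) # w) = fp_emb i x * word w" "word (u @ v) = word u * word v"
  by (simp_all add: word_def)

lemma fp_emb_diff: "fp_emb i (x - c *\<^sub>C 1) = fp_emb i x - c *\<^sub>C 1"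
proof -
  have "fp_emb i (x - c *\<^sub>C 1) + c *\<^sub>C 1 = fp_emb i ((x - c *\<^sub>C 1) + c *\<^sub>C 1)"
    by (simp only: unital_homD[OF unital_hom_fp_emb])
  then show ?thesis by (simp add: algebra_simps)
qed

lemma fp_emb_power: "fp_emb i x ^ n = fp_emb i (x ^ n)"
  by (induction n) (simp_all add: unital_homD[OF unital_hom_fp_emb])

text \<open>This is the unital subalgebra generated by the copies with index in \<open>I\<close>,
  presented by the spanning words that are centred below.\<close>

definition block :: "'i set \<Rightarrow> ('i, 'a::complex_algebra_1) free_product set" where
  "block I = cvs.span (word ` {w. fst ` set w \<subseteq> I})"

lemma word_in_block: "fst ` set w \<subseteq> I \<Longrightarrow> word w \<in> block I"
  unfolding block_def by (rule cvs.span_base) auto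

lemma block_one: "1 \<in> block I"
  using word_in_block[of "[]" I] by simp

lemma block_emb: "i \<in> I \<Longrightarrow> fp_emb i x \<in> block I"
  using word_in_block[of "[(i, x)]" I] by simp

lemma span_mult_closed:
  fixes A :: "'a::complex_algebra_1 set"
  assumes "\<And>x y. x \<in> A \<Longrightarrow> y \<in> A \<Longrightarrow> x * y \<in> A"
    and "x \<in> cvs.span A" "y \<in> cvs.span A"
  shows "x * y \<in> cvs.span A"
proof -
  have 1: "x * y \<in> cvs.span A" if "x \<in> A" "y \<in> cvs.span A" for x y
    using that(2)
  proof (induction rule: cvs.span_induct_alt)
    case base
    then show ?case by (simp add: cvs.span_zero)
  next
    case (step c z y)
    then show ?case using assms(1)[OF that(1)]
      by (simp add: distrib_left mult_scaleC_right cvs.span_add cvs.span_scale cvs.span_base)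
  qed
  show ?thesis
    using assms(2)
  proof (induction rule: cvs.span_induct_alt)
    case base
    then show ?case by (simp add: cvs.span_zero)
  next
    case (step c z x)
    then show ?case using 1 assms(3)
      by (simp add: distrib_right mult_scaleC_left cvs.span_add cvs.span_scale)
  qed
qed

lemma block_mult:
  assumes "x \<in> block I" "y \<in> block I"
  shows "x * y \<in> block I"
proof -
  have "word u * word v \<in> word ` {w. fst ` set w \<subseteq> I}"
    if "fst ` set u \<subseteq> I" "fst ` set v \<subseteq> I" for u v :: "('a \<times> 'b) list"
    by (rule image_eqI[of _ _ "u @ v"]) (use that in auto)
  then show ?thesis
    using assms unfolding block_def by (intro span_mult_closed) auto
qed

lemma block_diff: "x \<in> block I \<Longrightarrow> y \<in> block I \<Longrightarrow> x - y \<in> block I"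
  and block_scale: "x \<in> block I \<Longrightarrow> c *\<^sub>C x \<in> block I"
  and block_sum: "(\<And>i. i \<in> A \<Longrightarrow> h i \<in> block I) \<Longrightarrow> sum h A \<in> block I"
  unfolding block_def
  by (auto intro: cvs.span_diff cvs.span_scale cvs.span_sum)

lemma block_power: "x \<in> block I \<Longrightarrow> x ^ n \<in> block I"
  by (induction n) (auto intro: block_one block_mult)

text \<open>Every factor but the last is centred, also the first of several: another factor is to be
  put in front of it and makes it an inner one.\<close>

inductive alt_tail ::
  "(bool \<Rightarrow> 'u::complex_algebra_1 \<Rightarrow> complex) \<Rightarrow> (bool \<Rightarrow> 'u set) \<Rightarrow> bool \<Rightarrow> 'u \<Rightarrow> bool"
  for g S where
  last: "x \<in> S s \<Longrightarrow> alt_tail g S s x"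
| cons: "x \<in> S s \<Longrightarrow> g s x = 0 \<Longrightarrow> alt_tail g S (\<not> s) z \<Longrightarrow> alt_tail g S s (x * z)"

text \<open>Peeling off one factor after the other gives the product formula for alternating
  products with centred inner factors; the one-step form suits inductions.\<close>

definition factorizes ::
  "('u::complex_algebra_1 \<Rightarrow> complex) \<Rightarrow> (bool \<Rightarrow> 'u \<Rightarrow> complex) \<Rightarrow> (bool \<Rightarrow> 'u set) \<Rightarrow> bool" where
  "factorizes \<xi> g S \<longleftrightarrow>
     (\<forall>s x z. x \<in> S s \<longrightarrow> alt_tail g S (\<not> s) z \<longrightarrow> \<xi> (x * z) = \<xi> x * \<xi> z)"

section \<open>Centring the letters of a word\<close>

locale alpha_words =
  fixes \<psi> \<theta> :: "'a::complex_algebra_1 \<Rightarrow> complex"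
  assumes unital_\<psi>: "unital_functional \<psi>" and unital_\<theta>: "unital_functional \<theta>"
begin

text \<open>The functional at a letter with index \<open>i\<close> and left neighbour \<open>p\<close>; the third argument tells
  whether the right neighbour has a smaller index (\<^const>\<open>None\<close>: no right neighbour).\<close>

definition inner_functional :: "'i::linorder \<Rightarrow> 'i \<Rightarrow> bool option \<Rightarrow> 'a \<Rightarrow> complex" where
  "inner_functional p i d x =
     (case d of None \<Rightarrow> 0
      | Some below \<Rightarrow> if p < i \<and> below then \<psi> x else if i < p \<and> \<not> below then \<theta> x else 0)"

text \<open>The right neighbour of the last letter is described by \<open>e\<close>: absent (\<^const>\<open>None\<close>), above all
  letters (\<open>Some True\<close>) or below them (\<open>Some False\<close>).\<close>

fun next_below :: "bool option \<Rightarrow> 'i::linorder \<Rightarrow> ('i \<times> 'a) list \<Rightarrow> bool option" where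
  "next_below e i [] = map_option Not e"
| "next_below e i ((j, y) # w) = Some (j < i)"

fun inner_ok :: "bool option \<Rightarrow> 'i::linorder \<Rightarrow> ('i \<times> 'a) list \<Rightarrow> bool" where
  "inner_ok e p [] = True"
| "inner_ok e p ((i, x) # w) =
     (p \<noteq> i \<and> inner_functional p i (next_below e i w) x = 0 \<and> inner_ok e i w)"

fun centre :: "bool option \<Rightarrow> 'i::linorder \<Rightarrow> ('i \<times> 'a) list \<Rightarrow> ('i \<times> 'a) list" where
  "centre e p [] = []"
| "centre e p ((i, x) # w) =
     (i, x - inner_functional p i (next_below e i w) x *\<^sub>C 1) # centre e i w"

fun good :: "('a \<Rightarrow> complex) \<Rightarrow> bool option \<Rightarrow> ('i::linorder \<times> 'a) list \<Rightarrow> bool" where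
  "good \<xi> e [] = False"
| "good \<xi> e ((i, x) # w) = (\<xi> x = 0 \<and> inner_ok e i w)"

lemma next_below_centre [simp]: "next_below e i (centre e p w) = next_below e i w"
  by (cases w rule: pair_list_cases) auto

lemma map_fst_centre [simp]: "map fst (centre e p w) = map fst w"
  by (induction w arbitrary: p) auto

lemma inner_functional_centred:
  "inner_functional p i d (x - inner_functional p i d x *\<^sub>C 1) = 0"
  using centred_functional[OF unital_\<psi>, of x] centred_functional[OF unital_\<theta>, of x]
  by (auto simp: inner_functional_def split: option.splits)

lemma inner_ok_centre:
  "distinct_adj (p # map fst w) \<Longrightarrow> inner_ok e p (centre e p w)"
  by (induction w arbitrary: p) (auto simp: inner_functional_centred)

text \<open>Only the condition on the last letter involves \<open>e\<close>, and without a right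
  neighbour the functional there is 0.\<close>

lemma inner_ok_None: "inner_ok e p w \<Longrightarrow> inner_ok None p w"
proof (induction w arbitrary: p)
  case (Cons a w)
  obtain i x where a: "a = (i, x)" by force
  show ?case using Cons unfolding a
    by (cases w rule: pair_list_cases) (auto simp: inner_functional_def)
qed auto

text \<open>The direction \<open>up\<close> announced for the right neighbour is the actual
  direction of \<open>j\<close>, so every letter of \<open>w\<close> keeps its functional.\<close>

lemma inner_ok_append:
  assumes "inner_ok (Some up) p w"
    and "if up then last (p # map fst w) < j else j < last (p # map fst w)"
    and "inner_ok e (last (p # map fst w)) ((j, y) # v)"
  shows "inner_ok e p (w @ (j, y) # v)"
  using assms
proof (induction w arbitrary: p)
  case (Cons a w)
  obtain i x where a: "a = (i, x)" by force
  have "next_below e i (w @ (j, y) # v) = next_below (Some up) i w"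
    using Cons.prems(2) a by (cases w rule: pair_list_cases) (auto split: if_splits)
  moreover have "last (p # map fst (a # w)) = last (i # map fst w)"
    by (simp add: a)
  ultimately show ?case
    using Cons.prems Cons.IH[of i] unfolding a by (simp only: append_Cons inner_ok.simps simp_thms)
qed simp

lemma good_append:
  assumes "good \<xi> (Some up) w"
    and "if up then fst (last w) < j else j < fst (last w)"
    and "inner_ok e (fst (last w)) ((j, y) # v)"
  shows "good \<xi> e (w @ (j, y) # v)"
proof (cases w rule: pair_list_cases)
  case w: (Cons i x u)
  have "fst (last w) = last (i # map fst u)" by (simp add: w last_map)
  then have "inner_ok e i (u @ (j, y) # v)"
    using assms w by (intro inner_ok_append[of up]) auto
  then show ?thesis using assms(1) by (simp add: w)
qed (use assms in simp)

lemma inner_ok_nth: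
  assumes "inner_ok e p w" "k < length w"
  shows "inner_functional ((p # map fst w) ! k) (fst (w ! k))
      (next_below e (fst (w ! k)) (drop (Suc k) w)) (snd (w ! k)) = 0"
  using assms
proof (induction w arbitrary: p k)
  case (Cons a w)
  obtain i x where a: "a = (i, x)" by force
  show ?case using Cons by (cases k) (auto simp: a)
qed auto

lemma inner_ok_distinct_adj: "inner_ok e p w \<Longrightarrow> distinct_adj (p # map fst w)"
  by (induction w arbitrary: p) auto

text \<open>A good word meets the centring conditions at all its positions; announcing a right
  neighbour by \<open>e\<close> at most adds a condition on the last letter.\<close>

lemma good_vanishes:
  fixes \<xi> :: "'a \<Rightarrow> complex" and F :: "(nat, 'a) free_product \<Rightarrow> complex"
    and w :: "(nat \<times> 'a) list"
  assumes van: "vanishes_on_alternating (\<lambda>_. \<xi>) (\<lambda>_. \<psi>) (\<lambda>_. \<theta>) F"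
    and good: "good \<xi> e w"
  shows "F (word w) = 0"
proof (cases w rule: pair_list_cases)
  case Nil
  then show ?thesis using good by simp
next
  case w: (Cons i x v)
  have x: "\<xi> x = 0" and v: "inner_ok None i v"
    using good w inner_ok_None by auto
  have "position_functional (\<lambda>_. \<xi>) (\<lambda>_. \<psi>) (\<lambda>_. \<theta>) (map fst w) k (map snd w ! k) = 0"
    if k: "k < length w" for k
  proof (cases k)
    case 0
    then show ?thesis using x w by (simp add: position_functional_def)
  next
    case (Suc l)
    have l: "l < length v" using k Suc w by simp
    \<comment> \<open>Position \<open>l\<close> of \<open>v\<close> is position \<open>Suc l\<close>
      of \<open>w\<close>. It is the last one or has a right neighbour, which decides between peak
      and bottom.\<close>
    have *: "drop (Suc l) v = [] \<and> Suc l = length v \<or>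
        (Suc l < length v \<and> drop (Suc l) v = v ! Suc l # drop (Suc (Suc l)) v)"
      using l by (metis Cons_nth_drop_Suc Suc_lessI drop_all order_refl)
    have "map fst w ! Suc l = fst (v ! l)" "map snd w ! Suc l = snd (v ! l)"
      "map fst w ! l = (i # map fst v) ! l" "length (map fst w) = Suc (length v)"
      using l w by auto
    moreover have "map fst w ! Suc (Suc l) = fst (v ! Suc l)" if "Suc l < length v"
      using that w by auto
    moreover note inner_ok_nth[OF v l] *
    ultimately show ?thesis
      using Suc
      by (cases "v ! Suc l")
        (auto simp: position_functional_def peaks_def bottoms_def inner_functional_def
           split: option.splits if_splits)
  qed
  moreover have "distinct_adj (map fst w)"
    using inner_ok_distinct_adj[OF v] w by simp
  moreover have "word w = prod_list (map2 fp_emb (map fst w) (map snd w))"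
    by (simp add: word_def zip_map_fst_snd)
  ultimately show ?thesis
    using van w unfolding vanishes_on_alternating_def
    by (metis length_map list.distinct(1) map_is_Nil_conv)
qed

text \<open>Letters are centred one by one from the left. Subtracting a scalar c from a letter
  changes the word by c times the word without that letter, which is shorter. The scalar depends
  only on the letter and the indices of its neighbours, so earlier replacements do not affect
  it.\<close>

lemma word_centre_telescope:
  fixes w :: "('i::linorder \<times> 'a) list"
  assumes "\<And>v. length v < length u + length w \<Longrightarrow> fst ` set v \<subseteq> I \<Longrightarrow> word v \<in> cvs.span H"
    and "fst ` set u \<subseteq> I" "fst ` set w \<subseteq> I"
  shows "word (u @ w) - word (u @ centre e p w) \<in> cvs.span H"
  using assms
proof (induction w arbitrary: u p)
  case Nil
  then show ?case by (simp add: cvs.span_zero)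
next
  case (Cons a w)
  obtain i x where a: "a = (i, x)" by force
  define c where "c = inner_functional p i (next_below e i w) x"
  define u' where "u' = u @ [(i, x - c *\<^sub>C 1)]"
  have "word (u @ a # w) - word (u' @ w) = c *\<^sub>C word (u @ w)"
    by (simp add: a u'_def fp_emb_diff algebra_simps mult_scaleC_right mult_scaleC_left)
  moreover have "word (u @ w) \<in> cvs.span H"
    using Cons.prems by (intro Cons.prems(1)) auto
  ultimately have 1: "word (u @ a # w) - word (u' @ w) \<in> cvs.span H"
    by (simp add: cvs.span_scale)
  have "word (u' @ w) - word (u' @ centre e i w) \<in> cvs.span H"
    using Cons.prems by (intro Cons.IH) (auto simp: u'_def a)
  from cvs.span_add[OF 1 this] show ?case
    by (simp add: a u'_def c_def)
qed

text \<open>Induction on the length. Neighbouring letters from the same copy are merged; otherwise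
  the first letter is centred for \<open>\<xi>\<close> and the others for their inner functionals,
  all corrections being shorter words.\<close>

lemma word_in_span_good:
  fixes w :: "('i::linorder \<times> 'a) list"
  assumes \<xi>: "unital_functional \<xi>" and "fst ` set w \<subseteq> I"
  shows "word w \<in> cvs.span (insert 1 (word ` {v. good \<xi> e v \<and> fst ` set v \<subseteq> I}))"
    (is "_ \<in> cvs.span ?H")
  using assms(2)
proof (induction "length w" arbitrary: w rule: less_induct)
  case less
  show ?case
  proof (cases "distinct_adj (map fst w)")
    case False
    then obtain k where k: "Suc k < length w" "fst (w ! k) = fst (w ! Suc k)"
      by (auto simp: distinct_adj_conv_nth)
    then obtain i x y where "w ! k = (i, x)" "w ! Suc k = (i, y)"
      by (metis prod.collapse)
    then obtain u v where w: "w = u @ (i, x) # (i, y) # v"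
      using k by (metis Cons_nth_drop_Suc Suc_lessD id_take_nth_drop)
    have "word w = word (u @ (i, x * y) # v)"
      by (simp add: w unital_homD[OF unital_hom_fp_emb] mult.assoc)
    then show ?thesis
      using less(1)[of "u @ (i, x * y) # v"] less.prems by (simp add: w)
  next
    case True
    show ?thesis
    proof (cases w rule: pair_list_cases)
      case Nil
      then show ?thesis by (auto intro: cvs.span_base)
    next
      case w: (Cons i x v)
      define u where "u = [(i, x - \<xi> x *\<^sub>C 1)]"
      have "word (u @ v) - word (u @ centre e i v) \<in> cvs.span ?H"
        by (rule word_centre_telescope) (use less w in \<open>auto simp: u_def\<close>)
      moreover have "word (u @ centre e i v) \<in> cvs.span ?H"
      proof (intro cvs.span_base insertI2 image_eqI[OF refl] CollectI conjI)
        show "good \<xi> e (u @ centre e i v)"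
          using True w by (simp add: u_def centred_functional[OF \<xi>] inner_ok_centre)
        have "fst ` set (centre e i v) = fst ` set v"
          by (metis map_fst_centre set_map)
        then show "fst ` set (u @ centre e i v) \<subseteq> I"
          using less.prems w by (simp add: u_def)
      qed
      ultimately have "word (u @ v) \<in> cvs.span ?H"
        using cvs.span_add[of "word (u @ v) - word (u @ centre e i v)" ?H "word (u @ centre e i v)"]
        by simp
      moreover have "\<xi> x *\<^sub>C word v \<in> cvs.span ?H"
        by (rule cvs.span_scale) (use less w in auto)
      moreover have "word w = word (u @ v) + \<xi> x *\<^sub>C word v"
        by (simp add: w u_def fp_emb_diff algebra_simps mult_scaleC_left)
      ultimately show ?thesis by (simp add: cvs.span_add)
    qed
  qed
qed

lemma block_subset_span_good:
  fixes I :: "'i::linorder set"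
  assumes "unital_functional \<xi>"
  shows "block I \<subseteq> cvs.span (insert 1 (word ` {v. good \<xi> e v \<and> fst ` set v \<subseteq> I}))"
  unfolding block_def
  by (rule cvs.span_minimal) (auto intro!: word_in_span_good[OF assms] simp: cvs.subspace_span)

end

text \<open>The indices are cut at \<open>m\<close> into a left side (\<^const>\<open>True\<close>) and a right side (\<^const>\<open>False\<close>).\<close>

definition side :: "nat \<Rightarrow> bool \<Rightarrow> nat set" where
  "side m s = (if s then {..<m} else {m..})"

section \<open>Factorization over a left and a right block of copies\<close>

locale alpha_product = alpha_words \<psi> \<theta> for \<psi> \<theta> :: "'a::complex_algebra_1 \<Rightarrow> complex" +
  fixes \<psi>' \<theta>' :: "(nat, 'a) free_product \<Rightarrow> complex"
  assumes unital_\<psi>': "unital_functional \<psi>'" and unital_\<theta>': "unital_functional \<theta>'"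
    and vanishes_\<psi>': "vanishes_on_alternating (\<lambda>_. \<psi>) (\<lambda>_. \<psi>) (\<lambda>_. \<theta>) \<psi>'"
    and vanishes_\<theta>': "vanishes_on_alternating (\<lambda>_. \<theta>) (\<lambda>_. \<psi>) (\<lambda>_. \<theta>) \<theta>'"
begin

definition inner :: "bool \<Rightarrow> (nat, 'a) free_product \<Rightarrow> complex" where
  "inner s = (if s then \<theta>' else \<psi>')"

lemma unital_inner: "unital_functional (inner s)"
  by (simp add: inner_def unital_\<psi>' unital_\<theta>')

lemma inner_vanishes:
  "vanishes_on_alternating (\<lambda>_. if s then \<theta> else \<psi>) (\<lambda>_. \<psi>) (\<lambda>_. \<theta>) (inner s)"
  by (simp add: inner_def vanishes_\<psi>' vanishes_\<theta>')

lemma unital_letter: "unital_functional (if s then \<theta> else \<psi>)"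
  by (simp add: unital_\<psi> unital_\<theta>)

text \<open>A letter centred for \<open>\<theta>\<close> (left side) or \<open>\<psi>\<close> (right side) satisfies the condition on
  an inner letter preceded by a letter of the other side, whatever its right neighbour.\<close>

lemma good_append_side:
  assumes "good \<xi> (Some (\<not> s)) w" "fst (last w) \<in> side m (\<not> s)"
    and "good (if s then \<theta> else \<psi>) e v" "fst ` set v \<subseteq> side m s"
  shows "good \<xi> e (w @ v)"
proof (cases v rule: pair_list_cases)
  case v: (Cons j y u)
  show ?thesis unfolding v
    by (rule good_append[OF assms(1)])
      (use assms v in \<open>auto simp: side_def inner_functional_def split: if_splits option.splits\<close>)
qed (use assms in simp)

text \<open>Modulo scalars, elements of the block are combinations of good words; \<open>F\<close>
  kills these, so the scalar must be \<open>F x\<close>. The free parameter \<open>e\<close> allows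
  preparing the words for a right neighbour on either side.\<close>

lemma good_span_decomposition:
  fixes \<xi> :: "'a \<Rightarrow> complex" and F :: "(nat, 'a) free_product \<Rightarrow> complex"
  assumes "unital_functional \<xi>" "vanishes_on_alternating (\<lambda>_. \<xi>) (\<lambda>_. \<psi>) (\<lambda>_. \<theta>) F"
    and "unital_functional F" "x \<in> block I"
  shows "x - F x *\<^sub>C 1 \<in> cvs.span (word ` {v. good \<xi> e v \<and> fst ` set v \<subseteq> I})" (is "_ \<in> cvs.span ?H")
proof -
  have "x \<in> cvs.span (insert 1 ?H)"
    using block_subset_span_good[OF assms(1)] assms(4) by blast
  then obtain c where c: "x - c *\<^sub>C 1 \<in> cvs.span ?H"
    by (auto simp: cvs.span_insert)
  have "F y = 0" if "y \<in> cvs.span ?H" for y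
    using that
    by (induction rule: cvs.span_induct_alt)
      (auto simp: unital_functionalD[OF assms(3)] good_vanishes[OF assms(2)])
  from this[OF c] have "F x = c"
    by (simp add: unital_functionalD[OF assms(3)])
  with c show ?thesis by simp
qed

text \<open>The factors of \<open>z\<close> are expanded into good words, prepared for the next
  factor, and appended to \<open>w\<close>, which stays good. An inner factor has no scalar part
  since it is centred; the scalar part of the last factor contributes a multiple of
  \<open>F (word w) = 0\<close>.\<close>

lemma good_times_alt_tail_eq_0:
  fixes \<xi> :: "'a \<Rightarrow> complex" and F :: "(nat, 'a) free_product \<Rightarrow> complex"
  assumes van: "vanishes_on_alternating (\<lambda>_. \<xi>) (\<lambda>_. \<psi>) (\<lambda>_. \<theta>) F" and F: "unital_functional F"
    and "alt_tail inner (\<lambda>s. block (side m s)) s z"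
    and "good \<xi> (Some (\<not> s)) w" "fst (last w) \<in> side m (\<not> s)"
  shows "F (word w * z) = 0"
  using assms(3-)
proof (induction arbitrary: w rule: alt_tail.induct)
  case (last x s)
  have "x - inner s x *\<^sub>C 1 \<in> cvs.span (word ` {v. good (if s then \<theta> else \<psi>) None v \<and> fst ` set v \<subseteq> side m s})"
    by (rule good_span_decomposition[OF unital_letter inner_vanishes unital_inner last(1)])
  then have "F (word w * (x - inner s x *\<^sub>C 1)) = 0"
  proof (induction rule: cvs.span_induct_alt)
    case base
    then show ?case by (simp add: unital_functionalD[OF F])
  next
    case (step c y x)
    then show ?case
      using good_vanishes[OF van good_append_side[OF last(2,3)]]
      by (auto simp: distrib_left mult_scaleC_right unital_functionalD[OF F])
  qed
  moreover have "F (word w) = 0"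
    using good_vanishes[OF van last(2)] .
  ultimately show ?case
    by (simp add: right_diff_distrib mult_scaleC_right unital_functionalD[OF F])
next
  case (cons x s z)
  have "x - inner s x *\<^sub>C 1 \<in> cvs.span (word ` {v. good (if s then \<theta> else \<psi>) (Some s) v \<and> fst ` set v \<subseteq> side m s})"
    by (rule good_span_decomposition[OF unital_letter inner_vanishes unital_inner cons(1)])
  then have "x \<in> cvs.span (word ` {v. good (if s then \<theta> else \<psi>) (Some s) v \<and> fst ` set v \<subseteq> side m s})"
    using cons(2) by simp
  then show "F (word w * (x * z)) = 0"
  proof (induction rule: cvs.span_induct_alt)
    case base
    then show ?case by (simp add: unital_functionalD[OF F])
  next
    case (step c y x)
    then obtain v where v: "y = word v" "good (if s then \<theta> else \<psi>) (Some s) v" "fst ` set v \<subseteq> side m s"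
      by auto
    have "v \<noteq> []" using v by auto
    then have "F (word (w @ v) * z) = 0"
      using v good_append_side[OF cons(5,6) v(2,3)] by (intro cons(4)) auto
    then show ?case
      using step v by (simp add: distrib_left distrib_right mult.assoc mult_scaleC_right mult_scaleC_left unital_functionalD[OF F])
  qed
qed

text \<open>The part of \<open>x\<close> centred for \<open>F\<close> is a combination of good
  words, which contribute nothing in front of an alternating tail of the other side.\<close>

lemma factorizes_blocks:
  fixes \<xi> :: "'a \<Rightarrow> complex" and F :: "(nat, 'a) free_product \<Rightarrow> complex"
  assumes \<xi>: "unital_functional \<xi>"
    and van: "vanishes_on_alternating (\<lambda>_. \<xi>) (\<lambda>_. \<psi>) (\<lambda>_. \<theta>) F" and F: "unital_functional F"
  shows "factorizes F inner (\<lambda>s. block (side m s))"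
  unfolding factorizes_def
proof (intro allI impI)
  fix s and x z :: "(nat, 'a) free_product"
  assume x: "x \<in> block (side m s)" and z: "alt_tail inner (\<lambda>s. block (side m s)) (\<not> s) z"
  have "x - F x *\<^sub>C 1 \<in> cvs.span (word ` {v. good \<xi> (Some s) v \<and> fst ` set v \<subseteq> side m s})"
    by (rule good_span_decomposition[OF \<xi> van F x])
  then have "F ((x - F x *\<^sub>C 1) * z) = 0"
  proof (induction rule: cvs.span_induct_alt)
    case base
    then show ?case by (simp add: unital_functionalD[OF F])
  next
    case (step c y x)
    then obtain v where v: "y = word v" "good \<xi> (Some s) v" "fst ` set v \<subseteq> side m s"
      by auto
    have "v \<noteq> []" using v by auto
    then have "fst (last v) \<in> side m s"
      using v(3) last_in_set[OF \<open>v \<noteq> []\<close>] by blast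
    then have "F (word v * z) = 0"
      using v good_times_alt_tail_eq_0[OF van F z, of v] by auto
    then show ?case
      using step v by (simp add: distrib_right mult_scaleC_left unital_functionalD[OF F])
  qed
  then show "F (x * z) = F x * F z"
    by (simp add: left_diff_distrib mult_scaleC_left unital_functionalD[OF F])
qed

end

section \<open>Families of elements in two factorizing blocks\<close>

text \<open>Thanks to the abstraction the same expansion also shows, with the constant functions as
  scalars, that moments do not depend on the position of a block.\<close>

locale scalar_filtration =
  fixes P :: "nat \<Rightarrow> ('p \<Rightarrow> complex) set"
  assumes P_const: "(\<lambda>p. c) \<in> P 0"
    and P_zero: "(\<lambda>p. 0) \<in> P i"
    and P_add: "f \<in> P i \<Longrightarrow> h \<in> P i \<Longrightarrow> (\<lambda>p. f p + h p) \<in> P i"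
    and P_mult: "f \<in> P i \<Longrightarrow> h \<in> P j \<Longrightarrow> (\<lambda>p. f p * h p) \<in> P (i + j)"
    and P_Suc: "f \<in> P (Suc i) \<Longrightarrow> f \<in> P i"

text \<open>Applied below with \<open>p\<close> the number of copies in one of the blocks, \<open>P d\<close> the multiples of
  \<open>p\<^sup>d\<close> among the polynomials in \<open>p\<close> and \<open>wt\<close> the indicator of that block; where no orders are
  needed, \<open>wt\<close> is \<open>0\<close>.\<close>

locale block_families = scalar_filtration P for P :: "nat \<Rightarrow> ('p \<Rightarrow> complex) set" +
  fixes \<xi> :: "'u::complex_algebra_1 \<Rightarrow> complex" and g :: "bool \<Rightarrow> 'u \<Rightarrow> complex"
    and S :: "'p \<Rightarrow> bool \<Rightarrow> 'u set" and x :: "bool \<Rightarrow> 'p \<Rightarrow> 'u"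
    and wt :: "bool \<Rightarrow> nat" and K :: nat
  assumes unital_\<xi>: "unital_functional \<xi>" and unital_g: "unital_functional (g s)"
    and factorizes: "factorizes \<xi> g (S p)"
    and power_in_S: "x s p ^ k - c *\<^sub>C 1 \<in> S p s"
    and \<xi>_moment: "1 \<le> k \<Longrightarrow> k \<le> K \<Longrightarrow> (\<lambda>p. \<xi> (x s p ^ k)) \<in> P (wt s)"
    and g_moment: "1 \<le> k \<Longrightarrow> k \<le> K \<Longrightarrow> (\<lambda>p. g s (x s p ^ k)) \<in> P (wt s)"
begin

lemmas \<xi>_simps = unital_functionalD[OF unital_\<xi>]

lemma P_mono: "f \<in> P j \<Longrightarrow> i \<le> j \<Longrightarrow> f \<in> P i"
  by (induction j) (use P_Suc le_Suc_eq in auto)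

lemma P_cmult: "f \<in> P i \<Longrightarrow> (\<lambda>p. c * f p) \<in> P i"
  using P_mult[OF P_const, of f i c] by simp

lemma P_diff: "f \<in> P i \<Longrightarrow> h \<in> P i \<Longrightarrow> (\<lambda>p. f p - h p) \<in> P i"
  using P_add[OF _ P_cmult, of f i h "-1"] by simp

lemma power_in_S': "x s p ^ k \<in> S p s"
  using power_in_S[of s p k 0] by simp

section \<open>Expansion into alternating products of centred powers\<close>

definition centred_power :: "bool \<Rightarrow> nat \<Rightarrow> 'p \<Rightarrow> 'u" where
  "centred_power s k p = x s p ^ k - g s (x s p ^ k) *\<^sub>C 1"

text \<open>The third argument is a lower bound for the order of the value under
  \<open>\<xi>\<close>: each factor contributes the weight of its side. The product 1 counts as a
  tail of either side.\<close>

inductive tail :: "nat \<Rightarrow> bool \<Rightarrow> nat \<Rightarrow> ('p \<Rightarrow> 'u) \<Rightarrow> bool" for n where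
  one: "tail n s 0 (\<lambda>p. 1)"
| power: "1 \<le> k \<Longrightarrow> k \<le> n \<Longrightarrow> tail n s (wt s) (\<lambda>p. x s p ^ k)"
| cons: "1 \<le> k \<Longrightarrow> k \<le> n \<Longrightarrow> tail n (\<not> s) j T \<Longrightarrow>
    tail n s (wt s + j) (\<lambda>p. centred_power s k p * T p)"

lemma tail_alt_tail: "tail n s j T \<Longrightarrow> alt_tail g (S p) s (T p)"
proof (induction rule: tail.induct)
  case (one s)
  then show ?case using power_in_S'[of s p 0] by (auto intro: alt_tail.last)
next
  case (power k s)
  then show ?case by (auto intro: alt_tail.last power_in_S')
next
  case (cons k s j T)
  then show ?case
    by (auto intro!: alt_tail.cons simp: centred_power_def power_in_S centred_functional[OF unital_g])
qed

lemma \<xi>_mult_alt_tail: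
  "y \<in> S p s \<Longrightarrow> alt_tail g (S p) (\<not> s) z \<Longrightarrow> \<xi> (y * z) = \<xi> y * \<xi> z"
  using factorizes unfolding factorizes_def by blast

lemma tail_value: "tail n s j T \<Longrightarrow> n \<le> K \<Longrightarrow> (\<lambda>p. \<xi> (T p)) \<in> P j"
proof (induction rule: tail.induct)
  case (one s)
  then show ?case by (simp add: \<xi>_simps P_const)
next
  case (power k s)
  then show ?case by (auto intro: \<xi>_moment)
next
  case (cons k s j T)
  have "(\<lambda>p. \<xi> (x s p ^ k) - g s (x s p ^ k)) \<in> P (wt s)"
    using cons by (intro P_diff \<xi>_moment g_moment) auto
  then have "(\<lambda>p. (\<xi> (x s p ^ k) - g s (x s p ^ k)) * \<xi> (T p)) \<in> P (wt s + j)"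
    using cons by (intro P_mult) auto
  moreover have "\<xi> (centred_power s k p * T p) = \<xi> (centred_power s k p) * \<xi> (T p)" for p
    by (rule \<xi>_mult_alt_tail[OF _ tail_alt_tail[OF cons(3)]])
      (simp add: centred_power_def power_in_S)
  ultimately show ?case
    by (simp add: centred_power_def \<xi>_simps)
qed

lemma tail_mono: "tail n s j T \<Longrightarrow> n \<le> n' \<Longrightarrow> tail n' s j T"
  by (induction rule: tail.induct) (auto intro: tail.intros)

text \<open>These are the normal forms of words in the two elements: \<open>\<xi>\<close> maps them
  to scalars of order \<open>d\<close>, and left multiplication by either element preserves
  \<open>d\<close> and raises the bound \<open>n\<close> on the exponents by at most one.\<close>

inductive_set V :: "nat \<Rightarrow> nat \<Rightarrow> ('p \<Rightarrow> 'u) set" for n d where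
  zero: "(\<lambda>p. 0) \<in> V n d"
| step: "f \<in> P i \<Longrightarrow> tail n s j T \<Longrightarrow> d \<le> i + j \<Longrightarrow> X \<in> V n d \<Longrightarrow>
    (\<lambda>p. f p *\<^sub>C T p + X p) \<in> V n d"

lemma V_add: "X \<in> V n d \<Longrightarrow> Y \<in> V n d \<Longrightarrow> (\<lambda>p. X p + Y p) \<in> V n d"
proof (induction rule: V.induct)
  case (step f i s j T X)
  then show ?case
    using V.step[OF step(1-3), of "\<lambda>p. X p + Y p"] by (simp add: add.assoc)
qed simp

lemma V_tail: "tail n s j T \<Longrightarrow> d \<le> j \<Longrightarrow> T \<in> V n d"
  using V.step[OF P_const[of 1], of n s j T d "\<lambda>p. 0"] V.zero by (simp add: scaleC_one)

lemma V_scale: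
  assumes "f \<in> P e" "X \<in> V n d"
  shows "(\<lambda>p. f p *\<^sub>C X p) \<in> V n (e + d)"
  using assms(2)
proof (induction rule: V.induct)
  case zero
  then show ?case by (simp add: V.zero)
next
  case (step h i s j T X)
  have "(\<lambda>p. (f p * h p) *\<^sub>C T p + f p *\<^sub>C X p) \<in> V n (e + d)"
    using step assms(1) by (intro V.step[of _ "e + i" _ s j] P_mult) auto
  then show ?case by (simp add: scaleC_add_right scaleC_scaleC)
qed

lemma V_mono: "X \<in> V n d \<Longrightarrow> n \<le> n' \<Longrightarrow> d' \<le> d \<Longrightarrow> X \<in> V n' d'"
proof (induction rule: V.induct)
  case zero
  then show ?case by (simp add: V.zero)
next
  case (step h i s j T X)
  then show ?case by (intro V.step[of h i _ s j]) (auto intro: tail_mono)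
qed

lemma V_scale': "f \<in> P e \<Longrightarrow> X \<in> V n d \<Longrightarrow> d' \<le> e + d \<Longrightarrow> (\<lambda>p. f p *\<^sub>C X p) \<in> V n d'"
  using V_mono[OF V_scale, of f e X n d n d'] by simp

lemma V_uminus: "X \<in> V n d \<Longrightarrow> (\<lambda>p. - X p) \<in> V n d"
  using V_scale[OF P_const[of "-1"], of X n d] by (simp add: cvs.scale_minus_left)

lemma V_diff: "X \<in> V n d \<Longrightarrow> Y \<in> V n d \<Longrightarrow> (\<lambda>p. X p - Y p) \<in> V n d"
  using V_add[OF _ V_uminus, of X n d Y] by simp

lemma V_value: "X \<in> V n d \<Longrightarrow> n \<le> K \<Longrightarrow> (\<lambda>p. \<xi> (X p)) \<in> P d"
proof (induction rule: V.induct)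
  case zero
  then show ?case by (simp add: \<xi>_simps P_zero)
next
  case (step f i s j T X)
  then show ?case
    using P_mono[OF P_mult[OF step(1) tail_value[OF step(2)]], of d]
    by (simp add: \<xi>_simps P_add)
qed

text \<open>The new factor splits into its centred part, which extends the tail, and a scalar;
  either adds \<open>wt s\<close> to the order.\<close>

lemma V_mult_tail_other:
  assumes "tail n (\<not> s) j T" "1 \<le> n" "n \<le> K"
  shows "(\<lambda>p. x s p * T p) \<in> V n (wt s + j)"
proof -
  have "(\<lambda>p. centred_power s 1 p * T p + g s (x s p ^ 1) *\<^sub>C T p) \<in> V n (wt s + j)"
    using assms
    by (intro V_add V_tail[OF tail.cons] V_scale g_moment V_tail[OF assms(1)]) auto
  then show ?thesis
    by (simp add: centred_power_def left_diff_distrib mult_scaleC_left)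
qed

lemma V_mult_tail_same:
  assumes "tail n s j T" "Suc n \<le> K"
  shows "(\<lambda>p. x s p * T p) \<in> V (Suc n) j"
  using assms(1)
proof cases
  case one
  then show ?thesis
    using V_tail[OF tail.power[of 1 "Suc n" s], of 0] by simp
next
  case (power k)
  then show ?thesis
    using V_tail[OF tail.power[of "Suc k" "Suc n" s], of "wt s"] by simp
next
  case (cons k i T')
  note T' = tail_mono[OF cons(5), of "Suc n", simplified]
  \<comment> \<open>The element times its centred \<open>k\<close>-th power is the centred power of
    exponent \<open>Suc k\<close>, plus a scalar, minus a scalar multiple of the element; the latter
    now meets a tail of the other side.\<close>
  have "(\<lambda>p. (centred_power s (Suc k) p * T' p + g s (x s p ^ Suc k) *\<^sub>C T' p)
      - g s (x s p ^ k) *\<^sub>C (x s p * T' p)) \<in> V (Suc n) j"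
    unfolding cons(1)
    by (intro V_add V_diff V_tail[OF tail.cons[OF _ _ T']] V_scale g_moment V_tail[OF T']
         V_scale'[OF g_moment V_mult_tail_other[OF T']])
      (use cons assms in auto)
  then show ?thesis
    by (simp add: cons(2) centred_power_def algebra_simps mult_scaleC_left mult_scaleC_right)
qed

lemma V_mult:
  assumes "X \<in> V n d" "Suc n \<le> K"
  shows "(\<lambda>p. x s p * X p) \<in> V (Suc n) d"
  using assms
proof (induction rule: V.induct)
  case zero
  then show ?case by (simp add: V.zero)
next
  case (step f i s' j T X)
  have "(\<lambda>p. x s p * T p) \<in> V (Suc n) j"
  proof (cases "s' = s")
    case True
    then show ?thesis using V_mult_tail_same step by blast
  next
    case False
    then have "tail (Suc n) (\<not> s) j T"
      using tail_mono[OF step(2), of "Suc n"] by auto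
    from V_mult_tail_other[OF this] show ?thesis
      using step.prems by (auto intro: V_mono)
  qed
  then have "(\<lambda>p. f p *\<^sub>C (x s p * T p) + x s p * X p) \<in> V (Suc n) d"
    using step by (intro V_add V_scale'[OF step(1)]) auto
  then show ?case by (simp add: distrib_left mult_scaleC_right)
qed

lemma V_mult_power:
  assumes "X \<in> V n d" "n + k \<le> K"
  shows "(\<lambda>p. x s p ^ k * X p) \<in> V (n + k) d"
  using assms(2)
proof (induction k)
  case (Suc k)
  then show ?case using V_mult[of "\<lambda>p. x s p ^ k * X p" "n + k" d s] by (simp add: mult.assoc)
qed (use assms(1) in simp)

lemma V_power: "k \<le> K \<Longrightarrow> (\<lambda>p. x s p ^ k) \<in> V k 0"
  using V_mult_power[OF V_tail[OF tail.one], of 0 0 k] by simp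

lemma V_mult_sum_power:
  assumes "X \<in> V n d" "n + k \<le> K"
  shows "(\<lambda>p. (x s p + x (\<not> s) p) ^ k * X p) \<in> V (n + k) d"
  using assms(2)
proof (induction k)
  case 0
  then show ?case using assms(1) by simp
next
  case (Suc k)
  have "(\<lambda>p. x s p * ((x s p + x (\<not> s) p) ^ k * X p) + x (\<not> s) p * ((x s p + x (\<not> s) p) ^ k * X p))
      \<in> V (Suc (n + k)) d"
    using Suc by (intro V_add V_mult) auto
  then show ?case by (simp add: algebra_simps)
qed

text \<open>The exponents in the tails stay below \<open>n\<close>, which later permits induction on moments.\<close>

lemma sum_power_minus_powers_in_V:
  assumes "1 \<le> n" "n \<le> Suc K"
  shows "(\<lambda>p. (x s p + x (\<not> s) p) ^ n - x s p ^ n - x (\<not> s) p ^ n) \<in> V (n - 1) 0"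
  using assms
proof (induction n rule: nat_induct_at_least)
  case base
  then show ?case by (simp add: V.zero)
next
  case (Suc n)
  let ?D = "\<lambda>p. (x s p + x (\<not> s) p) ^ n - x s p ^ n - x (\<not> s) p ^ n"
  have D: "?D \<in> V (n - 1) 0" using Suc by simp
  have 1: "(\<lambda>p. x s p * ?D p) \<in> V n 0" "(\<lambda>p. x (\<not> s) p * ?D p) \<in> V n 0"
    using V_mult[OF D] Suc by auto
  have 2: "(\<lambda>p. x s p * x (\<not> s) p ^ n) \<in> V n 0" for s
    using V_mult_tail_other[OF tail.power[of n n "\<not> s"]] Suc
    by (auto intro: V_mono)
  have "(\<lambda>p. (x s p * ?D p + x (\<not> s) p * ?D p) + (x s p * x (\<not> s) p ^ n + x (\<not> s) p * x s p ^ n)) \<in> V n 0"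
    using 1 2[of s] 2[of "\<not> s"] by (intro V_add) auto
  then show ?case by (simp add: algebra_simps)
qed

lemma \<xi>_sum_power:
  assumes "1 \<le> n" "n \<le> Suc K"
  shows "(\<lambda>p. \<xi> ((x s p + x (\<not> s) p) ^ n) - \<xi> (x s p ^ n) - \<xi> (x (\<not> s) p ^ n)) \<in> P 0"
  using V_value[OF sum_power_minus_powers_in_V[OF assms, of s]] assms by (simp add: \<xi>_simps)

text \<open>The middle power splits into a scalar, which lets the outer powers merge, and its
  centred part, for which \<open>\<xi>\<close> factorizes.\<close>

lemma \<xi>_sandwich:
  "\<xi> (x (\<not> s) p ^ i * x s p ^ l * x (\<not> s) p ^ j) =
     g s (x s p ^ l) * \<xi> (x (\<not> s) p ^ (i + j))
     + \<xi> (x (\<not> s) p ^ i) * (\<xi> (x s p ^ l) - g s (x s p ^ l)) * \<xi> (x (\<not> s) p ^ j)"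
proof -
  let ?b = "centred_power s l p" and ?c = "\<lambda>k. x (\<not> s) p ^ k"
  have c: "alt_tail g (S p) (\<not> s) (?c j)"
    by (rule alt_tail.last[OF power_in_S'])
  have b: "?b \<in> S p s" "g s ?b = 0"
    by (simp_all add: centred_power_def power_in_S centred_functional[OF unital_g])
  have "alt_tail g (S p) s (?b * ?c j)"
    using b c by (intro alt_tail.cons) auto
  then have 1: "\<xi> (?c i * (?b * ?c j)) = \<xi> (?c i) * (\<xi> ?b * \<xi> (?c j))"
    using \<xi>_mult_alt_tail[OF power_in_S', where s = "\<not> s"] \<xi>_mult_alt_tail[OF b(1) c] by simp
  have 2: "?c i * (?b * ?c j) = ?c i * x s p ^ l * ?c j - g s (x s p ^ l) *\<^sub>C ?c (i + j)"
    by (simp add: centred_power_def algebra_simps mult_scaleC_left mult_scaleC_right power_add)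
  have 3: "\<xi> ?b = \<xi> (x s p ^ l) - g s (x s p ^ l)"
    by (simp add: centred_power_def \<xi>_simps)
  show ?thesis
    using 1 unfolding 2 3 by (simp add: \<xi>_simps algebra_simps)
qed

text \<open>The middle centred power keeps two factors of side \<open>s\<close> apart. In the second
  one, the centred part yields a tail with two factors of weight \<open>wt s\<close>; the scalar
  part has order \<open>wt s\<close> itself, and the first factor supplies the rest.\<close>

lemma V_separated:
  assumes "wt (\<not> s) = 0" "1 \<le> l" "1 \<le> i" "l \<le> n" "i + j \<le> n" "n \<le> K"
  shows "(\<lambda>p. x s p * (centred_power (\<not> s) i p * (x s p ^ l * x (\<not> s) p ^ j))) \<in> V n (2 * wt s)"
proof -
  have c: "tail n (\<not> s) 0 (\<lambda>p. x (\<not> s) p ^ k)" if "k \<le> n" for k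
    using tail.one[of n "\<not> s"] tail.power[of k n "\<not> s"] that assms(1) by (cases "k = 0") auto
  have 1: "(\<lambda>p. x s p * x (\<not> s) p ^ k) \<in> V n (wt s)" if "k \<le> n" for k
    using V_mult_tail_other[OF c[OF that]] assms by simp
  have "tail n s (wt s + 0) (\<lambda>p. centred_power s l p * x (\<not> s) p ^ j)"
    using assms by (intro tail.cons c) auto
  then have "tail n (\<not> s) (wt (\<not> s) + (wt s + 0))
      (\<lambda>p. centred_power (\<not> s) i p * (centred_power s l p * x (\<not> s) p ^ j))"
    using assms by (intro tail.cons) auto
  from V_mult_tail_other[OF this]
  have 2: "(\<lambda>p. x s p * (centred_power (\<not> s) i p * (centred_power s l p * x (\<not> s) p ^ j))) \<in> V n (2 * wt s)"
    using assms by (simp add: mult_2)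
  have "(\<lambda>p. g (\<not> s) (x (\<not> s) p ^ i) *\<^sub>C (x s p * x (\<not> s) p ^ j)) \<in> V n (wt s)"
    using V_scale[OF g_moment[of i "\<not> s"] 1[of j]] assms by simp
  from V_diff[OF 1[of "i + j"] this] 
  have 3: "(\<lambda>p. x s p * (centred_power (\<not> s) i p * x (\<not> s) p ^ j)) \<in> V n (wt s)"
    using assms by (simp add: centred_power_def algebra_simps power_add mult_scaleC_left mult_scaleC_right)
  have "(\<lambda>p. g s (x s p ^ l) *\<^sub>C (x s p * (centred_power (\<not> s) i p * x (\<not> s) p ^ j))) \<in> V n (2 * wt s)"
    using V_scale[OF g_moment[of l s] 3] assms by (simp add: mult_2)
  from V_add[OF 2 this] show ?thesis
    by (simp add: centred_power_def algebra_simps mult_scaleC_left mult_scaleC_right)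
qed

text \<open>Up to order \<open>2 * wt s\<close>, a power between two factors of side
  \<open>s\<close> acts like its moment: the error carries a centred power and is covered by
  \<open>V_separated\<close>, and further factors on the left preserve the order.\<close>

lemma \<xi>_separated:
  assumes "wt (\<not> s) = 0" "1 \<le> l" "l + i + j + k \<le> K"
  shows "(\<lambda>p. \<xi> ((x s p + x (\<not> s) p) ^ k * (x s p * x (\<not> s) p ^ i * x s p ^ l * x (\<not> s) p ^ j))
     - g (\<not> s) (x (\<not> s) p ^ i) * \<xi> ((x s p + x (\<not> s) p) ^ k * (x s p ^ Suc l * x (\<not> s) p ^ j)))
     \<in> P (2 * wt s)"
proof (cases "i = 0")
  case True
  then show ?thesis by (simp add: unital_functionalD[OF unital_g] P_zero mult.assoc)
next
  case False
  have "(\<lambda>p. (x s p + x (\<not> s) p) ^ k *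
      (x s p * (centred_power (\<not> s) i p * (x s p ^ l * x (\<not> s) p ^ j)))) \<in> V (l + i + j + k) (2 * wt s)"
    using assms False by (intro V_mult_sum_power V_separated) auto
  from V_value[OF this assms(3)] show ?thesis
    by (simp add: centred_power_def algebra_simps mult_scaleC_left mult_scaleC_right \<xi>_simps)
qed

end

section \<open>Polynomial sequences and their linear coefficients\<close>

lemma poly_eq_on_nat:
  fixes p q :: "complex poly"
  assumes "\<And>n::nat. poly p (of_nat n) = poly q (of_nat n)"
  shows "p = q"
proof (rule ccontr)
  assume "p \<noteq> q"
  then have "finite {z. poly (p - q) z = 0}" by (intro poly_roots_finite) simp
  moreover have "range (of_nat :: nat \<Rightarrow> complex) \<subseteq> {z. poly (p - q) z = 0}"
    using assms by auto
  ultimately have "finite (range (of_nat :: nat \<Rightarrow> complex))" by (rule finite_subset[rotated])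
  moreover have "inj (of_nat :: nat \<Rightarrow> complex)" by (simp add: inj_def)
  ultimately show False using finite_imageD infinite_UNIV_nat by blast
qed

definition interpolating_poly :: "(nat \<Rightarrow> complex) \<Rightarrow> complex poly" where
  "interpolating_poly f = (THE q. \<forall>n. poly q (of_nat n) = f n)"

lemma interpolating_polyI:
  assumes "\<And>n. f n = poly q (of_nat n)"
  shows "interpolating_poly f = q"
  unfolding interpolating_poly_def
  by (rule the_equality) (auto simp: assms intro: poly_eq_on_nat)

definition poly_order :: "nat \<Rightarrow> (nat \<Rightarrow> complex) set" where
  "poly_order d = {f. \<exists>q. \<forall>n. f n = of_nat n ^ d * poly q (of_nat n)}"

lemma poly_orderI: "(\<And>n. f n = of_nat n ^ d * poly q (of_nat n)) \<Longrightarrow> f \<in> poly_order d"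
  by (auto simp: poly_order_def)

lemma poly_interpolating_poly:
  assumes "f \<in> poly_order 0"
  shows "poly (interpolating_poly f) (of_nat n) = f n"
proof -
  obtain q where "\<And>n. f n = poly q (of_nat n)"
    using assms by (auto simp: poly_order_def)
  then show ?thesis using interpolating_polyI by metis
qed

interpretation poly_order: scalar_filtration poly_order
proof
  show "(\<lambda>p. c) \<in> poly_order 0" for c by (rule poly_orderI[of _ _ "[:c:]"]) simp
  show "(\<lambda>p. 0) \<in> poly_order i" for i by (rule poly_orderI[of _ _ 0]) simp
next
  fix f h i assume "f \<in> poly_order i" "h \<in> poly_order i"
  then obtain p q where "\<And>n. f n = of_nat n ^ i * poly p (of_nat n)"
    "\<And>n. h n = of_nat n ^ i * poly q (of_nat n)" by (auto simp: poly_order_def)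
  then show "(\<lambda>p. f p + h p) \<in> poly_order i"
    by (intro poly_orderI[of _ _ "p + q"]) (simp add: algebra_simps)
next
  fix f h i j assume "f \<in> poly_order i" "h \<in> poly_order j"
  then obtain p q where "\<And>n. f n = of_nat n ^ i * poly p (of_nat n)"
    "\<And>n. h n = of_nat n ^ j * poly q (of_nat n)" by (auto simp: poly_order_def)
  then show "(\<lambda>p. f p * h p) \<in> poly_order (i + j)"
    by (intro poly_orderI[of _ _ "p * q"]) (simp add: algebra_simps power_add)
next
  fix f i assume "f \<in> poly_order (Suc i)"
  then obtain p where "\<And>n. f n = of_nat n ^ Suc i * poly p (of_nat n)"
    by (auto simp: poly_order_def)
  then show "f \<in> poly_order i"
    by (intro poly_orderI[of _ _ "[:0, 1:] * p"]) simp
qed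

interpretation const: scalar_filtration "\<lambda>_. range (\<lambda>c :: complex. \<lambda>_ :: 'p. c)"
  by standard auto

lemma poly_order_1I:
  assumes "f \<in> poly_order 0" "f 0 = 0"
  shows "f \<in> poly_order 1"
proof -
  obtain q where q: "\<And>n. f n = poly q (of_nat n)"
    using assms by (auto simp: poly_order_def)
  then have "poly q 0 = 0" using assms(2) q[of 0] by simp
  then obtain r where "q = [:0, 1:] * r" by (metis dvdE poly_eq_0_iff_dvd minus_zero)
  then show ?thesis using q by (intro poly_orderI[of _ _ r]) simp
qed

text \<open>Induction on the degree: the difference of z^(d+1) has degree d with leading coefficient
  d + 1, so a multiple of it removes the leading term of \<open>p\<close>.\<close>

lemma ex_antidifference:
  fixes p :: "complex poly"
  shows "\<exists>q. \<forall>z. poly q (z + 1) - poly q z = poly p z"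
proof (induction "degree p" arbitrary: p rule: less_induct)
  case less
  define d where "d = degree p"
  define m :: "complex poly" where "m = monom 1 (Suc d)"
  define D where "D = pcompose m [:1, 1:] - m"
  have D: "poly D z = poly m (z + 1) - poly m z" for z
    by (simp add: D_def poly_pcompose add.commute)
  have D': "poly D z = (\<Sum>i\<le>d. of_nat (Suc d choose i) * z ^ i)" for z
  proof -
    have "(z + 1) ^ Suc d = (\<Sum>i\<le>Suc d. of_nat (Suc d choose i) * z ^ i * 1 ^ (Suc d - i))"
      by (rule binomial_ring)
    then show ?thesis
      unfolding D by (simp add: m_def poly_monom del: power_Suc binomial_Suc_Suc)
  qed
  have "D = (\<Sum>i\<le>d. monom (of_nat (Suc d choose i)) i)"
    by (rule poly_eq_on_nat) (simp add: D' poly_sum poly_monom)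
  then have cD: "coeff D k = (if k \<le> d then of_nat (Suc d choose k) else 0)" for k
    by (auto simp: coeff_sum if_distrib sum.delta cong: if_cong)
  have cd: "coeff D d = of_nat (Suc d)" using cD[of d] by simp
  define r where "r = p - smult (coeff p d / of_nat (Suc d)) D"
  have r: "coeff r k = 0" if "k \<ge> d" for k
  proof (cases "k = d")
    case True
    then show ?thesis using cd by (simp add: r_def del: of_nat_Suc)
  next
    case False
    then show ?thesis using that cD[of k] coeff_eq_0[of p k] by (simp add: r_def d_def)
  qed
  have "\<exists>q. \<forall>z. poly q (z + 1) - poly q z = poly r z"
  proof (cases "r = 0")
    case True
    then show ?thesis by (auto intro: exI[of _ 0])
  next
    case False
    then have "degree r < d" using r leading_coeff_0_iff not_less by blast
    then show ?thesis using less d_def by blast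
  qed
  then obtain q where q: "\<And>z. poly q (z + 1) - poly q z = poly r z" by blast
  have "poly p z = poly r z + coeff p d / of_nat (Suc d) * poly D z" for z
    by (simp add: r_def)
  then show ?case
    using q D by (intro exI[of _ "q + smult (coeff p d / of_nat (Suc d)) m"])
      (simp add: algebra_simps)
qed

lemma poly_order_0_sum:
  assumes "(\<lambda>n. f (Suc n) - f n) \<in> poly_order 0"
  shows "f \<in> poly_order 0"
proof -
  obtain p where p: "\<And>n. f (Suc n) - f n = poly p (of_nat n)"
    using assms by (auto simp: poly_order_def)
  obtain q where q: "\<And>z. poly q (z + 1) - poly q z = poly p z"
    using ex_antidifference by blast
  define c where "c = f 0 - poly q 0"
  have "f n = poly q (of_nat n) + c" for n
  proof (induction n)
    case (Suc n)
    then show ?case using p[of n] q[of "of_nat n"] by (simp add: algebra_simps)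
  qed (simp add: c_def)
  then show ?thesis by (intro poly_orderI[of _ _ "q + [:c:]"]) simp
qed

section \<open>Linear coefficients as derivatives\<close>

definition linear_coeff :: "(nat \<Rightarrow> complex) \<Rightarrow> complex" where
  "linear_coeff f = coeff (interpolating_poly f) 1"

lemma linear_coeffI: "(\<And>n. f n = poly q (of_nat n)) \<Longrightarrow> linear_coeff f = coeff q 1"
  by (simp add: linear_coeff_def interpolating_polyI)

lemma linear_coeff_const [simp]: "linear_coeff (\<lambda>_. c) = 0"
  using linear_coeffI[of "\<lambda>_. c" "[:c:]"] by simp

lemma linear_coeff_add:
  assumes "f \<in> poly_order 0" "h \<in> poly_order 0"
  shows "linear_coeff (\<lambda>n. f n + h n) = linear_coeff f + linear_coeff h"
proof -
  have "linear_coeff (\<lambda>n. f n + h n) = coeff (interpolating_poly f + interpolating_poly h) 1"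
    by (rule linear_coeffI) (simp add: assms poly_interpolating_poly)
  then show ?thesis by (simp add: linear_coeff_def)
qed

lemma linear_coeff_cmult:
  assumes "f \<in> poly_order 0"
  shows "linear_coeff (\<lambda>n. c * f n) = c * linear_coeff f"
proof -
  have "linear_coeff (\<lambda>n. c * f n) = coeff (smult c (interpolating_poly f)) 1"
    by (rule linear_coeffI) (simp add: assms poly_interpolating_poly)
  then show ?thesis by (simp add: linear_coeff_def)
qed

lemma linear_coeff_sum:
  assumes "\<And>i. i \<in> A \<Longrightarrow> f i \<in> poly_order 0"
  shows "(\<lambda>n. \<Sum>i\<in>A. f i n) \<in> poly_order 0 \<and>
    linear_coeff (\<lambda>n. \<Sum>i\<in>A. f i n) = (\<Sum>i\<in>A. linear_coeff (f i))"
  using assms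
proof (induction A rule: infinite_finite_induct)
  case (insert i A)
  then show ?case
    using linear_coeff_add[of "f i" "\<lambda>n. \<Sum>i\<in>A. f i n"] poly_order.P_add[of "f i" 0 "\<lambda>n. \<Sum>i\<in>A. f i n"]
    by simp
qed (simp_all add: poly_order.P_const)

lemma linear_coeff_order_2:
  assumes "f \<in> poly_order 2"
  shows "linear_coeff f = 0"
proof -
  obtain q where "\<And>n. f n = of_nat n ^ 2 * poly q (of_nat n)"
    using assms by (auto simp: poly_order_def)
  then have "linear_coeff f = coeff (monom 1 2 * q) 1"
    by (intro linear_coeffI) (simp add: poly_monom)
  then show ?thesis by (simp add: coeff_monom_mult)
qed

text \<open>The derivative at \<open>N\<close> thus becomes the linear coefficient in the number of
  copies added to \<open>N\<close> copies.\<close>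

lemma linear_coeff_shift:
  "linear_coeff (\<lambda>n. poly q (of_nat (n + N))) = poly (pderiv q) (of_nat N)"
proof -
  have "linear_coeff (\<lambda>n. poly q (of_nat (n + N))) = coeff (pcompose q [:of_nat N, 1:]) 1"
    by (rule linear_coeffI) (simp add: poly_pcompose add.commute)
  also have "\<dots> = poly (pderiv (pcompose q [:of_nat N, 1:])) 0"
    by (simp add: poly_0_coeff_0 coeff_pderiv)
  also have "\<dots> = poly (pderiv q) (of_nat N)"
    by (simp add: pderiv_pcompose poly_pcompose pderiv_pCons)
  finally show ?thesis .
qed

text \<open>The words are sorted by the position of the last \<open>x\<close>; \<open>i\<close>
  counts the factors \<open>y\<close> after it.\<close>

lemma add_power_last_occurrence:
  fixes x y :: "'a::ring_1"
  shows "(x + y) ^ n = y ^ n + (\<Sum>i<n. (x + y) ^ (n - 1 - i) * (x * y ^ i))"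
proof (induction n)
  case (Suc n)
  have "(x + y) ^ Suc n = (x + y) ^ n * x + (x + y) ^ n * y"
    by (simp only: power_Suc2 distrib_left)
  also have "(x + y) ^ n * y = y ^ Suc n + (\<Sum>i<n. (x + y) ^ (n - 1 - i) * (x * y ^ Suc i))"
    by (subst Suc) (simp add: distrib_right sum_distrib_right power_commutes mult.assoc)
  finally show ?case
    by (simp add: sum.lessThan_Suc_shift add_ac del: sum.lessThan_Suc power_Suc)
qed simp

text \<open>Iteration gives the sum over l of \<open>Q ^ l\<close> times the l-th inhomogeneous
  term, a convergent series since \<open>Q\<close> has no constant term.\<close>

lemma fps_recursion_solution:
  fixes E :: "nat \<Rightarrow> complex fps"
  assumes E: "\<And>l. E l = fps_const (c l) * X + fps_const (d l) * Y + Q * E (Suc l)"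
    and Q: "fps_nth Q 0 = 0"
  shows "E 0 = (Abs_fps c oo Q) * X + (Abs_fps d oo Q) * Y"
proof -
  \<comment> \<open>\<open>R l\<close> is the expected value of \<open>E l\<close>, built from the
    shifted coefficients. It solves the same recursion, so \<open>E 0 - R 0\<close> is divisible by
    every power of \<open>Q\<close>.\<close>
  define R where "R l = (Abs_fps (\<lambda>k. c (k + l)) oo Q) * X + (Abs_fps (\<lambda>k. d (k + l)) oo Q) * Y" for l
  have shift: "Abs_fps (\<lambda>k. h (k + l)) oo Q = fps_const (h l) + Q * (Abs_fps (\<lambda>k. h (k + Suc l)) oo Q)"
    for h :: "nat \<Rightarrow> complex" and l
  proof -
    have "Abs_fps (\<lambda>k. h (k + l)) = fps_const (h l) + fps_X * Abs_fps (\<lambda>k. h (k + Suc l))"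
      by (rule fps_ext) (auto simp: gr0_conv_Suc)
    then show ?thesis
      by (simp add: fps_compose_add_distrib fps_compose_mult_distrib[OF Q]
          fps_X_fps_compose_startby0[OF Q])
  qed
  have diff: "E l - R l = Q * (E (Suc l) - R (Suc l))" for l
    unfolding E[of l] R_def shift[of _ l] by (simp add: algebra_simps)
  have pow: "E 0 - R 0 = Q ^ r * (E r - R r)" for r
  proof (induction r)
    case (Suc r)
    then show ?case unfolding diff[of r] by (simp only: power_Suc2 mult.assoc)
  qed simp
  have "fps_nth (E 0 - R 0) n = 0" for n
  proof -
    have "fps_nth (Q ^ Suc n) i = 0" if "i \<le> n" for i
      using startsby_zero_power_prefix[OF Q, of "Suc n"] that by simp
    then show ?thesis
      unfolding pow[of "Suc n"] fps_mult_nth by (intro sum.neutral) auto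
  qed
  then have "E 0 = R 0" by (metis fps_ext eq_iff_diff_eq_0 fps_zero_nth)
  then show ?thesis by (simp add: R_def)
qed

section \<open>Moments of sums of copies\<close>

definition copies :: "nat \<Rightarrow> nat \<Rightarrow> 'a::complex_algebra_1 \<Rightarrow> (nat, 'a) free_product" where
  "copies M N a = (\<Sum>j\<in>{M..<M + N}. fp_emb j a)"

lemma copies_0 [simp]: "copies M 0 a = 0"
  by (simp add: copies_def)

lemma copies_Suc: "copies M (Suc N) a = fp_emb M a + copies (Suc M) N a"
  by (simp add: copies_def sum.atLeast_Suc_lessThan)

lemma copies_add: "copies M (N + N') a = copies M N a + copies (M + N) N' a"
  by (simp add: copies_def add.assoc sum.atLeastLessThan_concat)

lemma sum_of_copies_eq: "sum_of_copies N a = copies 0 N a"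
  by (simp add: sum_of_copies_def copies_def lessThan_atLeast0)

lemma copies_in_block: "{M..<M + N} \<subseteq> I \<Longrightarrow> copies M N a \<in> block I"
  unfolding copies_def by (intro block_sum block_emb) auto

context alpha_product
begin

text \<open>One argument serves all three product functionals. Inductions on moments need this
  generality, as moments for \<open>\<psi>'\<close> and \<open>\<theta>'\<close> enter those for
  \<open>F\<close>.\<close>

definition admissible :: "('a \<Rightarrow> complex) \<Rightarrow> ((nat, 'a) free_product \<Rightarrow> complex) \<Rightarrow> bool" where
  "admissible \<xi> F \<longleftrightarrow> unital_functional \<xi> \<and> unital_functional F \<and>
     vanishes_on_alternating (\<lambda>_. \<xi>) (\<lambda>_. \<psi>) (\<lambda>_. \<theta>) F"

lemma admissible_inner: "admissible (if s then \<theta> else \<psi>) (inner s)"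
  by (simp add: admissible_def unital_letter unital_inner inner_vanishes)

lemma admissible_unital: "admissible \<xi> F \<Longrightarrow> unital_functional F"
  by (simp add: admissible_def)

lemma admissible_fp_emb:
  assumes "admissible \<xi> F"
  shows "F (fp_emb i x) = \<xi> x"
proof -
  have F: "unital_functional F" and \<xi>: "unital_functional \<xi>"
    and van: "vanishes_on_alternating (\<lambda>_. \<xi>) (\<lambda>_. \<psi>) (\<lambda>_. \<theta>) F"
    using assms by (auto simp: admissible_def)
  have "F (word [(i, x - \<xi> x *\<^sub>C 1)]) = 0"
    by (rule good_vanishes[OF van, of None]) (simp add: centred_functional[OF \<xi>])
  then show ?thesis by (simp add: fp_emb_diff unital_functionalD[OF F])
qed

lemma block_families_blocks:
  assumes "scalar_filtration P" "admissible \<xi> F"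
    and "\<And>s p. x s p \<in> block (side (m p) s)"
    and "\<And>k s. 1 \<le> k \<Longrightarrow> k \<le> K \<Longrightarrow> (\<lambda>p. F (x s p ^ k)) \<in> P (wt s)"
    and "\<And>k s. 1 \<le> k \<Longrightarrow> k \<le> K \<Longrightarrow> (\<lambda>p. inner s (x s p ^ k)) \<in> P (wt s)"
  shows "block_families P F inner (\<lambda>p s. block (side (m p) s)) x wt K"
proof (intro block_families.intro assms(1) block_families_axioms.intro)
  show "factorizes F inner (\<lambda>s. block (side (m p) s))" for p
    using assms(2) by (auto simp: admissible_def intro: factorizes_blocks)
  show "x s p ^ k - c *\<^sub>C 1 \<in> block (side (m p) s)" for s p k c
    by (intro block_diff block_power block_scale block_one assms(3))
qed (use assms admissible_unital unital_inner in auto)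

text \<open>Induction on \<open>N\<close>, splitting off the first copy. The parameter of the
  families is the starting index \<open>M\<close> and the scalars are constants, so lying in the
  filtration means independence of \<open>M\<close>.\<close>

lemma moments_copies_shift:
  assumes "admissible \<xi> F"
  shows "F (copies M N a ^ n) = F (copies 0 N a ^ n)"
proof -
  have "(\<lambda>M. F (copies M N a ^ n)) \<in> range (\<lambda>c _. c)"
    using assms
  proof (induction N arbitrary: \<xi> F n)
    case 0
    then show ?case by simp
  next
    case (Suc N)
    define x where "x s M = (if s then fp_emb M a else copies (Suc M) N a)" for s M
    have mom: "(\<lambda>M. F (x s M ^ k)) \<in> range (\<lambda>c _. c)" if F: "admissible \<xi> F" for \<xi> F s k
    proof (cases s)
      case True
      then show ?thesis by (simp add: x_def fp_emb_power admissible_fp_emb[OF F])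
    next
      case False
      obtain c where "(\<lambda>M. F (copies M N a ^ k)) = (\<lambda>_. c)"
        using Suc.IH[OF F, of k] by auto
      then have "(\<lambda>M. F (copies (Suc M) N a ^ k)) = (\<lambda>_. c)" by (auto simp: fun_eq_iff)
      then show ?thesis using False by (simp add: x_def)
    qed
    interpret block_families "\<lambda>_. range (\<lambda>c _. c)" F inner "\<lambda>p s. block (side (Suc p) s)" x "\<lambda>_. 0" n
    proof (rule block_families_blocks[OF const.scalar_filtration_axioms Suc.prems])
      show "x s p \<in> block (side (Suc p) s)" for s p
        by (auto simp: side_def x_def intro!: block_emb copies_in_block)
    qed (use mom Suc.prems admissible_inner in blast)+
    show ?case
    proof (cases "n = 0")
      case False
      then have "(\<lambda>M. F ((x True M + x (\<not> True) M) ^ n) - F (x True M ^ n) - F (x (\<not> True) M ^ n))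
          \<in> range (\<lambda>c _. c)"
        by (intro \<xi>_sum_power) auto
      from const.P_add[OF const.P_add[OF this mom[OF Suc.prems, of True n]] mom[OF Suc.prems, of False n]]
      show ?thesis by (simp add: x_def copies_Suc)
    qed simp
  qed
  then show ?thesis by (auto simp: fun_eq_iff image_iff)
qed

text \<open>Strong induction on \<open>n\<close>. One more copy changes the moment by a constant and
  by mixed terms, which involve only moments of degree at most \<open>n - 1\<close>; so the
  difference in \<open>N\<close> is polynomial, and it can be summed.\<close>

lemma moments_copies_polynomial:
  assumes "admissible \<xi> F"
  shows "(\<lambda>N. F (copies 0 N a ^ n)) \<in> poly_order 0"
  using assms
proof (induction n arbitrary: \<xi> F rule: less_induct)
  case (less n)
  show ?case
  proof (cases "n = 0")
    case True
    then show ?thesis by (simp add: poly_order.P_const)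
  next
    case False
    define x where "x s N = (if s then fp_emb 0 a else copies 1 N a)" for s N
    have mom: "(\<lambda>N. F (x s N ^ k)) \<in> poly_order 0" if F: "admissible \<xi> F" and "k < n" for \<xi> F s k
      using less.IH[OF that(2) F] moments_copies_shift[OF F, of 1] poly_order.P_const
      by (cases s) (simp_all add: x_def)
    interpret block_families poly_order F inner "\<lambda>p s. block (side 1 s)" x "\<lambda>_. 0" "n - 1"
    proof (rule block_families_blocks[OF poly_order.scalar_filtration_axioms less.prems])
      show "x s p \<in> block (side 1 s)" for s p
        by (auto simp: side_def x_def intro!: block_emb copies_in_block)
      have "k < n" if "1 \<le> k" "k \<le> n - 1" for k
        using that by simp
      then show "(\<lambda>p. F (x s p ^ k)) \<in> poly_order 0" "(\<lambda>p. inner s (x s p ^ k)) \<in> poly_order 0"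
        if "1 \<le> k" "k \<le> n - 1" for k s
        using that mom less.prems admissible_inner by blast+
    qed
    have "(\<lambda>N. F ((x True N + x (\<not> True) N) ^ n) - F (x True N ^ n) - F (x (\<not> True) N ^ n))
        \<in> poly_order 0"
      using False by (intro \<xi>_sum_power) auto
    from poly_order.P_add[OF this poly_order.P_const[of "F (fp_emb 0 a ^ n)"]]
    have "(\<lambda>N. F (copies 0 (Suc N) a ^ n) - F (copies 0 N a ^ n)) \<in> poly_order 0"
      using moments_copies_shift[OF less.prems, of 1] by (simp add: x_def copies_Suc)
    then show ?thesis by (rule poly_order_0_sum)
  qed
qed

definition moment_poly :: "((nat, 'a) free_product \<Rightarrow> complex) \<Rightarrow> 'a \<Rightarrow> nat \<Rightarrow> complex poly" where
  "moment_poly F a n = interpolating_poly (\<lambda>N. F (copies 0 N a ^ n))"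

lemma poly_moment_poly:
  "admissible \<xi> F \<Longrightarrow> poly (moment_poly F a n) (of_nat N) = F (copies M N a ^ n)"
  using poly_interpolating_poly[OF moments_copies_polynomial, of \<xi> F a n N]
    moments_copies_shift[of \<xi> F M N a n]
  by (simp add: moment_poly_def)

lemma moment_poly_0: "admissible \<xi> F \<Longrightarrow> moment_poly F a 0 = 1"
  by (rule poly_eq_on_nat)
    (simp add: poly_moment_poly[where M = 0] unital_functionalD[OF admissible_unital])

lemma poly_moment_poly_0: "admissible \<xi> F \<Longrightarrow> 1 \<le> n \<Longrightarrow> poly (moment_poly F a n) 0 = 0"
  using poly_moment_poly[of \<xi> F a n 0 0]
  by (simp add: unital_functionalD[OF admissible_unital] power_0_left)

text \<open>\<open>M\<close> copies on the side \<open>s\<close> are joined to \<open>N\<close> copies on the other side; the part linear in \<open>M\<close>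
  of the moments of the sum is their derivative at \<open>N\<close>.\<close>

definition joint_copies :: "'a \<Rightarrow> nat \<Rightarrow> bool \<Rightarrow> bool \<Rightarrow> nat \<Rightarrow> (nat, 'a) free_product" where
  "joint_copies a N s s' M =
     (if s' = s then copies (if s then 0 else N) M a else copies (if s then M else 0) N a)"

lemma joint_copies_sum: "joint_copies a N s s M + joint_copies a N s (\<not> s) M = copies 0 (M + N) a"
  using copies_add[of 0 M N a] copies_add[of 0 N M a]
  by (cases s) (auto simp: joint_copies_def add.commute)

text \<open>The side with \<open>M\<close> copies has weight 1 because its moments of positive
  degree vanish at \<open>M = 0\<close>; those of the other side do not depend on
  \<open>M\<close>.\<close>

lemma block_families_joint_copies:
  assumes "admissible \<xi> F"
  shows "block_families poly_order F inner (\<lambda>M s'. block (side (if s then M else N) s'))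
     (joint_copies a N s) (\<lambda>s'. if s' = s then 1 else 0) K"
proof (rule block_families_blocks[OF poly_order.scalar_filtration_axioms assms])
  show "joint_copies a N s s' M \<in> block (side (if s then M else N) s')" for s' M
    by (auto simp: joint_copies_def side_def intro!: copies_in_block)
  have "(\<lambda>M. F (joint_copies a N s s' M ^ k)) \<in> poly_order (if s' = s then 1 else 0)"
    if F: "admissible \<xi> F" and "1 \<le> k" for \<xi> F s' k
  proof (cases "s' = s")
    case True
    have "(\<lambda>M. F (copies (if s then 0 else N) M a ^ k)) \<in> poly_order 1"
    proof (rule poly_order_1I)
      show "(\<lambda>M. F (copies (if s then 0 else N) M a ^ k)) \<in> poly_order 0"
        using moments_copies_polynomial[OF F] moments_copies_shift[OF F, of N] by simp
      show "F (copies (if s then 0 else N) 0 a ^ k) = 0"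
        using that by (simp add: power_0_left unital_functionalD[OF admissible_unital])
    qed
    then show ?thesis using True by (simp add: joint_copies_def)
  next
    case False
    have "F (copies (if s then M else 0) N a ^ k) = F (copies 0 N a ^ k)" for M
      using moments_copies_shift[OF F, of M] by simp
    then show ?thesis using False by (simp add: joint_copies_def poly_order.P_const)
  qed
  then show "(\<lambda>M. F (joint_copies a N s s' M ^ k)) \<in> poly_order (if s' = s then 1 else 0)"
    "(\<lambda>M. inner s' (joint_copies a N s s' M ^ k)) \<in> poly_order (if s' = s then 1 else 0)"
    if "1 \<le> k" "k \<le> K" for k s'
    using that assms admissible_inner by blast+
qed

text \<open>Words in the \<open>M\<close> added and the \<open>N\<close> old copies are reduced from
  the right. Modulo \<open>M^2\<close>, each further factor from the added copies joins those
  collected so far, at the price of a moment of the old ones; in the generating function this is a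
  factor \<open>Q\<close>.\<close>

lemma pderiv_moment_poly_at_nat:
  fixes a :: 'a and N :: nat and s :: bool
  assumes F: "admissible \<xi> F"
  defines "\<Lambda> \<equiv> Abs_fps (\<lambda>n. poly (moment_poly F a n) (of_nat N))"
    and "Q \<equiv> fps_X * Abs_fps (\<lambda>n. poly (moment_poly (inner (\<not> s)) a n) (of_nat N))"
    and "A \<equiv> Abs_fps (\<lambda>l. coeff (moment_poly F a (Suc l)) 1)"
    and "C \<equiv> Abs_fps (\<lambda>l. coeff (moment_poly (inner s) a (Suc l)) 1)"
  shows "Abs_fps (\<lambda>n. poly (pderiv (moment_poly F a n)) (of_nat N)) =
    fps_X * ((C oo Q) * fps_deriv (fps_X * \<Lambda>) + ((A - C) oo Q) * \<Lambda>\<^sup>2)"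
proof -
  define b where "b = joint_copies a N s s"
  define c where "c = joint_copies a N s (\<not> s)"
  define \<mu> where "\<mu> i = poly (moment_poly (inner (\<not> s)) a i) (of_nat N)" for i
  define \<kappa> where "\<kappa> i = poly (moment_poly F a i) (of_nat N)" for i
  define \<alpha> where "\<alpha> l = coeff (moment_poly F a l) 1" for l
  define \<gamma> where "\<gamma> l = coeff (moment_poly (inner s) a l) 1" for l
  \<comment> \<open>\<open>l\<close> counts the collected factors \<open>b\<close>, \<open>j\<close>
    the factors \<open>c\<close> to their right, and \<open>k\<close> is the part not yet
    expanded.\<close>
  define e where "e l k j = linear_coeff (\<lambda>M. F ((b M + c M) ^ k * (b M ^ l * c M ^ j)))" for l k j
  have c_moment: "inner (\<not> s) (c M ^ i) = \<mu> i" "F (c M ^ i) = \<kappa> i" for M i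
    using poly_moment_poly[OF admissible_inner, of "\<not> s" a i N]
      poly_moment_poly[OF F, of a i N]
    by (simp_all add: c_def joint_copies_def \<mu>_def \<kappa>_def)
  have b_moment: "inner s (b M ^ i) = poly (moment_poly (inner s) a i) (of_nat M)"
      "F (b M ^ i) = poly (moment_poly F a i) (of_nat M)" for M i
    using poly_moment_poly[OF admissible_inner, of s a i M]
      poly_moment_poly[OF F, of a i M]
    by (simp_all add: b_def joint_copies_def)
  note Fs = unital_functionalD[OF admissible_unital[OF F]]

  have poly_word: "(\<lambda>M. F ((b M + c M) ^ k * (b M ^ l * c M ^ j))) \<in> poly_order 0"
      "(\<lambda>M. F (c M ^ k * (b M ^ l * c M ^ j))) \<in> poly_order 0" for k l j
  proof -
    interpret block_families poly_order F inner "\<lambda>M s'. block (side (if s then M else N) s')"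
      "joint_copies a N s" "\<lambda>s'. if s' = s then 1 else 0" "j + l + k"
      by (rule block_families_joint_copies[OF F])
    have w: "(\<lambda>M. b M ^ l * c M ^ j) \<in> V (j + l) 0"
      unfolding b_def c_def by (intro V_mult_power V_power) auto
    show "(\<lambda>M. F ((b M + c M) ^ k * (b M ^ l * c M ^ j))) \<in> poly_order 0"
      using V_value[OF V_mult_sum_power[OF w, of k s]] by (simp add: b_def c_def)
    show "(\<lambda>M. F (c M ^ k * (b M ^ l * c M ^ j))) \<in> poly_order 0"
      using V_value[OF V_mult_power[OF w, of k "\<not> s"]] by (simp add: c_def)
  qed
  have e_sandwich: "linear_coeff (\<lambda>M. F (c M ^ i * (b M ^ l * c M ^ j)))
      = \<gamma> l * \<kappa> (i + j) + \<kappa> i * (\<alpha> l - \<gamma> l) * \<kappa> j" for i l j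
  proof -
    interpret block_families poly_order F inner "\<lambda>M s'. block (side (if s then M else N) s')"
      "joint_copies a N s" "\<lambda>s'. if s' = s then 1 else 0" 0
      by (rule block_families_joint_copies[OF F])
    have "linear_coeff (\<lambda>M. F (c M ^ i * (b M ^ l * c M ^ j))) =
      coeff (smult (\<kappa> (i + j)) (moment_poly (inner s) a l)
        + smult (\<kappa> i * \<kappa> j) (moment_poly F a l - moment_poly (inner s) a l)) 1"
      by (rule linear_coeffI)
        (use \<xi>_sandwich[of s] c_moment b_moment
         in \<open>simp add: b_def[symmetric] c_def[symmetric] mult.assoc algebra_simps\<close>)
    then show ?thesis by (simp add: \<alpha>_def \<gamma>_def algebra_simps)
  qed
  have e_separated: "linear_coeff (\<lambda>M. F ((b M + c M) ^ k * (b M * c M ^ i * (b M ^ l * c M ^ j))))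
      = \<mu> i * e (Suc l) k j \<and>
      (\<lambda>M. F ((b M + c M) ^ k * (b M * c M ^ i * (b M ^ l * c M ^ j)))) \<in> poly_order 0"
    if "1 \<le> l" for k i l j
  proof -
    interpret block_families poly_order F inner "\<lambda>M s'. block (side (if s then M else N) s')"
      "joint_copies a N s" "\<lambda>s'. if s' = s then 1 else 0" "l + i + j + k"
      by (rule block_families_joint_copies[OF F])
    let ?f = "\<lambda>M. F ((b M + c M) ^ k * (b M * c M ^ i * (b M ^ l * c M ^ j)))"
    let ?h = "\<lambda>M. \<mu> i * F ((b M + c M) ^ k * (b M ^ Suc l * c M ^ j))"
    have d: "(\<lambda>M. ?f M - ?h M) \<in> poly_order 2"
      using \<xi>_separated[of s l i j k] that c_moment
      by (simp add: b_def[symmetric] c_def[symmetric] mult.assoc)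
    have h: "?h \<in> poly_order 0" by (intro P_cmult poly_word(1))
    have d0: "(\<lambda>M. ?f M - ?h M) \<in> poly_order 0" by (rule P_mono[OF d]) simp
    have "linear_coeff (\<lambda>M. (?f M - ?h M) + ?h M) = linear_coeff ?h"
      by (simp only: linear_coeff_add[OF d0 h] linear_coeff_order_2[OF d] add_0)
    moreover have "linear_coeff ?h = \<mu> i * e (Suc l) k j"
      unfolding e_def by (rule linear_coeff_cmult[OF poly_word(1)])
    moreover have "(\<lambda>M. (?f M - ?h M) + ?h M) \<in> poly_order 0"
      by (rule poly_order.P_add[OF d0 h])
    ultimately show ?thesis by simp
  qed
  \<comment> \<open>Either the unexpanded power contributes no \<open>b\<close>, leaving a sandwich,
    or its last \<open>b\<close> is separated from the collected ones by a power of
    \<open>c\<close>, which is replaced by its moment.\<close>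
  have e_rec: "e l n j = (\<gamma> l * \<kappa> (n + j) + \<kappa> n * (\<alpha> l - \<gamma> l) * \<kappa> j)
      + (\<Sum>i<n. \<mu> i * e (Suc l) (n - 1 - i) j)" if "1 \<le> l" for l n j
  proof -
    let ?g = "\<lambda>i M. F ((b M + c M) ^ (n - 1 - i) * (b M * c M ^ i * (b M ^ l * c M ^ j)))"
    have "F ((b M + c M) ^ n * (b M ^ l * c M ^ j)) =
        F (c M ^ n * (b M ^ l * c M ^ j)) + (\<Sum>i<n. ?g i M)" for M
      by (subst add_power_last_occurrence)
        (simp add: distrib_right sum_distrib_right Fs mult.assoc)
    then show ?thesis
      using linear_coeff_sum[of "{..<n}" ?g] e_separated[OF that]
      by (simp add: e_def linear_coeff_add poly_word(2) e_sandwich)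
  qed
  \<comment> \<open>The shift to \<open>Suc l\<close> reflects that at least one \<open>b\<close> is
    present. Summation over \<open>j\<close> turns the terms of \<open>e_rec\<close> into the
    derivative of \<open>fps_X * \<Lambda>\<close>, the square of \<open>\<Lambda>\<close> and a
    product with \<open>Q\<close>.\<close>
  define E where "E l = Abs_fps (\<lambda>n. \<Sum>j\<le>n. e (Suc l) (n - j) j)" for l
  have "E l = fps_const (\<gamma> (Suc l)) * fps_deriv (fps_X * \<Lambda>) + fps_const (\<alpha> (Suc l) - \<gamma> (Suc l)) * \<Lambda>\<^sup>2
      + Q * E (Suc l)" for l
  proof (rule fps_ext)
    fix n
    have \<Lambda>: "\<Lambda> = Abs_fps \<kappa>" and Q: "Q = fps_X * Abs_fps \<mu>"
      by (simp_all add: \<Lambda>_def Q_def flip: \<kappa>_def \<mu>_def)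
    have 1: "(\<Sum>j\<le>n. \<kappa> (n - j + j)) = fps_nth (fps_deriv (fps_X * \<Lambda>)) n"
      by (simp add: \<Lambda> algebra_simps)
    have 2: "(\<Sum>j\<le>n. \<kappa> (n - j) * \<kappa> j) = fps_nth (\<Lambda>\<^sup>2) n"
      by (simp add: \<Lambda> power2_eq_square fps_mult_nth atLeast0AtMost mult.commute)
    have 3: "(\<Sum>j\<le>n. \<Sum>i<n - j. \<mu> i * e (Suc (Suc l)) (n - j - 1 - i) j) = fps_nth (Q * E (Suc l)) n"
    proof (cases n)
      case 0
      then show ?thesis by (simp add: Q mult.assoc)
    next
      case (Suc m)
      have "fps_nth (Q * E (Suc l)) n = (\<Sum>i\<le>m. \<Sum>j\<le>m - i. \<mu> i * e (Suc (Suc l)) (m - i - j) j)"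
        by (simp add: Q E_def Suc mult.assoc fps_mult_nth[of "Abs_fps \<mu>"] atLeast0AtMost sum_distrib_left)
      also have "\<dots> = (\<Sum>j\<le>n. \<Sum>i<n - j. \<mu> i * e (Suc (Suc l)) (n - j - 1 - i) j)"
        unfolding sum.Sigma[OF finite_atMost ballI[OF finite_atMost]]
          sum.Sigma[OF finite_atMost ballI[OF finite_lessThan]]
        by (rule sum.reindex_bij_witness[of _ "\<lambda>(j, i). (i, j)" "\<lambda>(i, j). (j, i)"])
          (auto simp: Suc intro!: arg_cong2[of _ _ _ _ "\<lambda>k. e (Suc (Suc l)) k"])
      finally show ?thesis by simp
    qed
    have "fps_nth (E l) n = \<gamma> (Suc l) * (\<Sum>j\<le>n. \<kappa> (n - j + j))
      + (\<alpha> (Suc l) - \<gamma> (Suc l)) * (\<Sum>j\<le>n. \<kappa> (n - j) * \<kappa> j)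
      + (\<Sum>j\<le>n. \<Sum>i<n - j. \<mu> i * e (Suc (Suc l)) (n - j - 1 - i) j)"
      unfolding E_def fps_nth_Abs_fps sum_distrib_left[of "\<gamma> (Suc l)"]
        sum_distrib_left[of "\<alpha> (Suc l) - \<gamma> (Suc l)"] sum.distrib[symmetric]
      by (rule sum.cong[OF refl]) (simp add: e_rec[of "Suc l"] mult_ac)
    then show "fps_nth (E l) n = fps_nth (fps_const (\<gamma> (Suc l)) * fps_deriv (fps_X * \<Lambda>)
        + fps_const (\<alpha> (Suc l) - \<gamma> (Suc l)) * \<Lambda>\<^sup>2 + Q * E (Suc l)) n"
      unfolding 1 2 3 by simp
  qed
  moreover have "fps_nth Q 0 = 0" by (simp add: Q_def)
  ultimately have "E 0 = (Abs_fps (\<lambda>l. \<gamma> (Suc l)) oo Q) * fps_deriv (fps_X * \<Lambda>)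
      + (Abs_fps (\<lambda>l. \<alpha> (Suc l) - \<gamma> (Suc l)) oo Q) * \<Lambda>\<^sup>2"
    by (rule fps_recursion_solution)
  also have "Abs_fps (\<lambda>l. \<gamma> (Suc l)) = C"
    by (simp add: \<gamma>_def C_def)
  also have "Abs_fps (\<lambda>l. \<alpha> (Suc l) - \<gamma> (Suc l)) = A - C"
    by (rule fps_ext) (simp add: \<alpha>_def \<gamma>_def A_def C_def)
  finally have E0: "E 0 = (C oo Q) * fps_deriv (fps_X * \<Lambda>) + ((A - C) oo Q) * \<Lambda>\<^sup>2" .
  have "poly (pderiv (moment_poly F a n)) (of_nat N) = fps_nth (fps_X * E 0) n" for n
  proof (cases n)
    case 0
    then show ?thesis by (simp add: moment_poly_0[OF F])
  next
    case (Suc m)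
    let ?g = "\<lambda>i M. F ((b M + c M) ^ (m - i) * (b M * c M ^ i))"
    have "poly (pderiv (moment_poly F a n)) (of_nat N)
        = linear_coeff (\<lambda>M. poly (moment_poly F a n) (of_nat (M + N)))"
      by (simp only: linear_coeff_shift)
    \<comment> \<open>The word without \<open>b\<close> gives the constant
      \<open>\<kappa> n\<close>, which has no linear coefficient.\<close>
    also have "(\<lambda>M. poly (moment_poly F a n) (of_nat (M + N))) = (\<lambda>M. \<kappa> n + (\<Sum>i\<le>m. ?g i M))"
    proof
      fix M
      have "poly (moment_poly F a n) (of_nat (M + N)) = F ((b M + c M) ^ n)"
        unfolding poly_moment_poly[OF F, where M = 0]
        by (simp add: b_def c_def joint_copies_sum)
      also have "\<dots> = \<kappa> n + (\<Sum>i\<le>m. ?g i M)"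
        by (subst add_power_last_occurrence) (simp add: Fs c_moment Suc lessThan_Suc_atMost del: power_Suc)
      finally show "poly (moment_poly F a n) (of_nat (M + N)) = \<kappa> n + (\<Sum>i\<le>m. ?g i M)" .
    qed
    also have "linear_coeff \<dots> = (\<Sum>i\<le>m. e 1 (m - i) i)"
      using linear_coeff_sum[of "{..m}" ?g] poly_word(1)[of _ 1]
      by (simp add: linear_coeff_add poly_order.P_const e_def)
    finally show ?thesis by (simp add: Suc E_def)
  qed
  then show ?thesis by (intro fps_ext) (simp add: E0)
qed

end

section \<open>Power series with polynomial coefficients\<close>

text \<open>Through this property identities known for natural numbers of copies extend to all
  parameters.\<close>

definition poly_fps :: "(complex \<Rightarrow> complex fps) \<Rightarrow> bool" where
  "poly_fps G \<longleftrightarrow> (\<forall>n. \<exists>p. \<forall>z. fps_nth (G z) n = poly p z)"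

lemma poly_fpsI: "(\<And>z n. fps_nth (G z) n = poly (p n) z) \<Longrightarrow> poly_fps G"
  by (auto simp: poly_fps_def)

lemma poly_fpsE:
  assumes "poly_fps G"
  obtains p where "\<And>z n. fps_nth (G z) n = poly (p n) z"
  using assms unfolding poly_fps_def by metis

lemma poly_fps_const [intro]: "poly_fps (\<lambda>_. f)"
  by (rule poly_fpsI[of _ "\<lambda>n. [:fps_nth f n:]"]) simp

lemma poly_fps_add [intro]:
  assumes "poly_fps G" "poly_fps H"
  shows "poly_fps (\<lambda>z. G z + H z)"
proof -
  obtain p q where "\<And>z n. fps_nth (G z) n = poly (p n) z" "\<And>z n. fps_nth (H z) n = poly (q n) z"
    using assms by (metis poly_fpsE)
  then show ?thesis by (intro poly_fpsI[of _ "\<lambda>n. p n + q n"]) simp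
qed

lemma poly_fps_mult [intro]:
  assumes "poly_fps G" "poly_fps H"
  shows "poly_fps (\<lambda>z. G z * H z)"
proof -
  obtain p q where "\<And>z n. fps_nth (G z) n = poly (p n) z" "\<And>z n. fps_nth (H z) n = poly (q n) z"
    using assms by (metis poly_fpsE)
  then show ?thesis
    by (intro poly_fpsI[of _ "\<lambda>n. \<Sum>i=0..n. p i * q (n - i)"]) (simp add: fps_mult_nth poly_sum)
qed

lemma poly_fps_power [intro]: "poly_fps G \<Longrightarrow> poly_fps (\<lambda>z. G z ^ k)"
  by (induction k) auto

lemma poly_fps_compose [intro]:
  assumes "poly_fps G"
  shows "poly_fps (\<lambda>z. f oo G z)"
proof -
  have "\<exists>p. \<forall>n z. fps_nth (G z ^ k) n = poly (p n) z" for k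
    using poly_fps_power[OF assms, of k] by (metis poly_fpsE)
  then obtain p where "\<And>k n z. fps_nth (G z ^ k) n = poly (p k n) z" by metis
  then show ?thesis
    by (intro poly_fpsI[of _ "\<lambda>n. \<Sum>i=0..n. smult (fps_nth f i) (p i n)"])
      (simp add: fps_compose_nth poly_sum)
qed

lemma poly_fps_deriv [intro]:
  assumes "poly_fps G"
  shows "poly_fps (\<lambda>z. fps_deriv (G z))"
proof -
  obtain p where "\<And>z n. fps_nth (G z) n = poly (p n) z"
    using assms by (metis poly_fpsE)
  then show ?thesis by (intro poly_fpsI[of _ "\<lambda>n. smult (of_nat (n + 1)) (p (n + 1))"]) simp
qed

text \<open>The coefficients of the inverse are found recursively; as the constant term is 1, no
  division occurs.\<close>

lemma poly_fps_inverse: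
  assumes "poly_fps G" "\<And>z. fps_nth (G z) 0 = 1"
  shows "poly_fps (\<lambda>z. inverse (G z))"
proof -
  obtain p where p: "\<And>z n. fps_nth (G z) n = poly (p n) z"
    using assms by (metis poly_fpsE)
  have "\<exists>q. \<forall>z. fps_nth (inverse (G z)) n = poly q z" for n
  proof (induction n rule: less_induct)
    case (less n)
    then obtain q where q: "\<And>i z. i < n \<Longrightarrow> fps_nth (inverse (G z)) i = poly (q i) z" by metis
    show ?case
    proof (cases "n = 0")
      case True
      then show ?thesis using assms(2) by (auto intro: exI[of _ 1])
    next
      case False
      have "fps_nth (inverse (G z)) n = poly (- (\<Sum>i<n. q i * p (n - i))) z" for z
      proof -
        have "0 = fps_nth (inverse (G z) * G z) n"
          using False assms(2)[of z] by (simp add: inverse_mult_eq_1)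
        also have "\<dots> = (\<Sum>i<n. poly (q i) z * poly (p (n - i)) z) + fps_nth (inverse (G z)) n"
          using assms(2)[of z] q p
          by (simp add: fps_mult_nth atLeast0AtMost sum.atMost_shift flip: lessThan_Suc_atMost)
        finally show ?thesis by (simp add: poly_sum eq_neg_iff_add_eq_0 add.commute)
      qed
      then show ?thesis by blast
    qed
  qed
  then show ?thesis by (simp add: poly_fps_def)
qed

lemma poly_fps_eq_on_nat:
  assumes "poly_fps G" "poly_fps H" "\<And>n::nat. G (of_nat n) = H (of_nat n)"
  shows "G z = H z"
proof (rule fps_ext)
  fix k
  obtain p q where p: "\<And>z n. fps_nth (G z) n = poly (p n) z" "\<And>z n. fps_nth (H z) n = poly (q n) z"
    using assms by (metis poly_fpsE)
  have "p k = q k" by (rule poly_eq_on_nat) (metis assms(3) p)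
  then show "fps_nth (G z) k = fps_nth (H z) k" using p by metis
qed

section \<open>Coefficientwise derivatives of power series\<close>

definition fps_has_deriv :: "(real \<Rightarrow> complex fps) \<Rightarrow> complex fps \<Rightarrow> real \<Rightarrow> bool" where
  "fps_has_deriv G D t \<longleftrightarrow>
     (\<forall>n. ((\<lambda>s. fps_nth (G s) n) has_vector_derivative fps_nth D n) (at t))"

lemma has_vector_derivative_poly:
  "((\<lambda>s. poly p (of_real s :: complex)) has_vector_derivative poly (pderiv p) (of_real t)) (at t)"
  by (rule has_vector_derivative_real_field) (rule poly_DERIV)

lemma fps_has_deriv_poly:
  assumes "\<And>s n. fps_nth (G s) n = poly (p n) (of_real s)"
  shows "fps_has_deriv G (Abs_fps (\<lambda>n. poly (pderiv (p n)) (of_real t))) t"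
  by (simp add: fps_has_deriv_def assms has_vector_derivative_poly)

lemma fps_has_deriv_mult:
  assumes "fps_has_deriv G D t" "fps_has_deriv H E t"
  shows "fps_has_deriv (\<lambda>s. G s * H s) (G t * E + D * H t) t"
  using assms unfolding fps_has_deriv_def fps_mult_nth fps_add_nth sum.distrib[symmetric]
  by (auto intro!: has_vector_derivative_sum has_vector_derivative_mult)

lemma fps_has_deriv_unique:
  "fps_has_deriv G D t \<Longrightarrow> fps_has_deriv G E t \<Longrightarrow> D = E"
  unfolding fps_has_deriv_def by (intro fps_ext) (metis vector_derivative_at)

text \<open>The inverse has polynomial coefficients, hence a derivative; its value follows by
  differentiating the product of the series and its inverse.\<close>

lemma fps_has_deriv_inverse:
  assumes G: "poly_fps G" "\<And>z. fps_nth (G z) 0 = 1"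
    and D: "fps_has_deriv (\<lambda>s. G (of_real s)) D t"
  shows "fps_has_deriv (\<lambda>s. inverse (G (of_real s))) (- (inverse (G (of_real t)))\<^sup>2 * D) t"
proof -
  let ?I = "\<lambda>s :: real. inverse (G (of_real s))"
  obtain p where "\<And>z n. fps_nth (inverse (G z)) n = poly (p n) z"
    using poly_fps_inverse[OF G] by (metis poly_fpsE)
  then have "\<exists>E. fps_has_deriv ?I E t"
    using fps_has_deriv_poly[of ?I p t] by auto
  then obtain E where E: "fps_has_deriv ?I E t" ..
  have inv: "?I s * G (of_real s) = 1" for s
    using G(2)[of "of_real s"] by (intro inverse_mult_eq_1) simp
  have "fps_has_deriv (\<lambda>s. ?I s * G (of_real s)) (?I t * D + E * G (of_real t)) t"
    by (rule fps_has_deriv_mult[OF E D])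
  moreover have "fps_has_deriv (\<lambda>s. ?I s * G (of_real s)) 0 t"
    by (simp add: inv fps_has_deriv_def)
  ultimately have "?I t * D + E * G (of_real t) = 0"
    by (rule fps_has_deriv_unique)
  then have "(?I t * D + E * G (of_real t)) * ?I t = 0" by simp
  then have "(?I t)\<^sup>2 * D + E * (?I t * G (of_real t)) = 0"
    by (simp add: algebra_simps power2_eq_square)
  then have "E = - (?I t)\<^sup>2 * D" unfolding inv by (simp add: eq_neg_iff_add_eq_0 add.commute)
  then show ?thesis using E by simp
qed

context alpha_product
begin

definition moment_series :: "((nat, 'a) free_product \<Rightarrow> complex) \<Rightarrow> 'a \<Rightarrow> complex \<Rightarrow> complex fps" where
  "moment_series F a z = Abs_fps (\<lambda>n. poly (moment_poly F a n) z)"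

text \<open>This is the derivative of the moment series at 0, divided by \<open>fps_X\<close>; its
  negative turns out to be the derivative of the F-transform at 0.\<close>

definition generator_series :: "((nat, 'a) free_product \<Rightarrow> complex) \<Rightarrow> 'a \<Rightarrow> complex fps" where
  "generator_series F a = Abs_fps (\<lambda>l. coeff (moment_poly F a (Suc l)) 1)"

lemma poly_fps_moment_series [intro]: "poly_fps (moment_series F a)"
  by (rule poly_fpsI) (simp add: moment_series_def)

lemma moment_series_nth_0:
  "admissible \<xi> F \<Longrightarrow> fps_nth (moment_series F a z) 0 = 1"
  by (simp add: moment_series_def moment_poly_0)

lemma moment_series_at_0:
  assumes "admissible \<xi> F"
  shows "moment_series F a 0 = 1"
proof (rule fps_ext)
  show "fps_nth (moment_series F a 0) n = fps_nth 1 n" for n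
    using moment_poly_0[OF assms] poly_moment_poly_0[OF assms, of n]
    by (cases "n = 0") (auto simp: moment_series_def)
qed

lemma moment_series_deriv:
  fixes a :: 'a and s :: bool
  assumes F: "admissible \<xi> F"
  defines "Q \<equiv> \<lambda>z. fps_X * moment_series (inner (\<not> s)) a z"
  shows "Abs_fps (\<lambda>n. poly (pderiv (moment_poly F a n)) z) =
    fps_X * ((generator_series (inner s) a oo Q z) * fps_deriv (fps_X * moment_series F a z)
      + ((generator_series F a - generator_series (inner s) a) oo Q z) * (moment_series F a z)\<^sup>2)"
  unfolding Q_def
proof (rule poly_fps_eq_on_nat[where z = z])
  show "poly_fps (\<lambda>z. Abs_fps (\<lambda>n. poly (pderiv (moment_poly F a n)) z))"
    by (rule poly_fpsI) simp
  show "Abs_fps (\<lambda>n. poly (pderiv (moment_poly F a n)) (of_nat N)) =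
      fps_X * ((generator_series (inner s) a oo fps_X * moment_series (inner (\<not> s)) a (of_nat N))
          * fps_deriv (fps_X * moment_series F a (of_nat N))
        + ((generator_series F a - generator_series (inner s) a)
            oo fps_X * moment_series (inner (\<not> s)) a (of_nat N)) * (moment_series F a (of_nat N))\<^sup>2)"
    for N
    unfolding moment_series_def generator_series_def by (rule pderiv_moment_poly_at_nat[OF F])
qed (intro poly_fps_add poly_fps_mult poly_fps_compose poly_fps_deriv poly_fps_power poly_fps_const
      poly_fps_moment_series)

section \<open>Transforms of the convolution group in terms of moment series\<close>

lemma G_transform_conv_group:
  "G_transform (conv_group F a t) = fps_to_fls (fps_X * moment_series F a (of_real t))"
proof -
  have "conv_group F a t (monom 1 n) = poly (moment_poly F a n) (of_real t)" for n
    by (simp add: conv_group_def interpolate_def functional_of_moments_monom distr_of_def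
        sum_of_copies_eq moment_poly_def interpolating_poly_def)
  then show ?thesis
    by (simp add: G_transform_def moment_series_def fls_times_fps_to_fls)
qed

lemma F_transform_conv_group:
  assumes "admissible \<xi> F"
  shows "F_transform (conv_group F a t) = fls_shift 1 (fps_to_fls (inverse (moment_series F a (of_real t))))"
proof -
  have "subdegree (moment_series F a (of_real t)) = 0"
    using moment_series_nth_0[OF assms] by (simp add: subdegree_eq_0_iff)
  then show ?thesis
    by (simp add: F_transform_def G_transform_conv_group fls_times_fps_to_fls fls_inverse_X
        divide_inverse fls_inverse_fps_to_fls fls_X_inv_times_conv_shift)
qed

lemma compose_z_F_transform:
  assumes "admissible \<xi> F"
  shows "fps_to_fls f \<circ>\<^sub>z F_transform (conv_group F a t) =
    fps_to_fls (f oo (fps_X * moment_series F a (of_real t)))"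
proof -
  have "moment_series F a (of_real t) \<noteq> 0"
    using moment_series_nth_0[OF assms] by (metis fps_zero_nth zero_neq_one)
  then show ?thesis
    by (simp add: compose_z_def F_transform_def G_transform_conv_group)
qed

text \<open>With w = 1/z and G equal to w times the moment series, F = 1/G has z-derivative w^2
  G'/G^2, where G' is the derivative in w.\<close>

lemma deriv_z_F_transform:
  fixes a :: 'a
  assumes F: "admissible \<xi> F"
  defines "\<Lambda> \<equiv> \<lambda>t. moment_series F a (of_real t)"
  shows "deriv_z (F_transform (conv_group F a t)) =
    fps_to_fls ((inverse (\<Lambda> t))\<^sup>2 * fps_deriv (fps_X * \<Lambda> t))"
proof -
  let ?I = "inverse (\<Lambda> t)"
  have \<Lambda>: "fps_nth (\<Lambda> t) 0 \<noteq> 0"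
    by (simp add: \<Lambda>_def moment_series_nth_0[OF F])
  have "?I\<^sup>2 * fps_deriv (fps_X * \<Lambda> t) = ?I * (?I * \<Lambda> t) - fps_X * fps_deriv ?I"
    by (simp add: fps_inverse_deriv[OF \<Lambda>] power2_eq_square algebra_simps)
  also have "\<dots> = ?I - fps_X * fps_deriv ?I"
    by (simp add: inverse_mult_eq_1[OF \<Lambda>])
  also have "fps_to_fls \<dots> = deriv_z (F_transform (conv_group F a t))"
  proof (rule fls_eqI)
    fix n
    have *: "deriv_z (F_transform (conv_group F a t)) = - fls_shift (-2) (fls_deriv (fls_shift 1 (fps_to_fls ?I)))"
      unfolding deriv_z_def F_transform_conv_group[OF F] \<Lambda>_def
      by (simp add: fls_X_power_conv_shift_1 fls_shifted_times_simps)
    show "fls_nth (fps_to_fls (?I - fps_X * fps_deriv ?I)) n =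
        fls_nth (deriv_z (F_transform (conv_group F a t))) n"
    proof (cases "n < 0")
      case False
      then obtain k where "n = int k" by (metis nonneg_int_cases not_less)
      with * show ?thesis by (cases k) (auto simp: algebra_simps)
    qed (use * in simp)
  qed
  finally show ?thesis by simp
qed

text \<open>F is z divided by the moment series. In its t-derivative the factor z cancels the
  \<open>fps_X\<close> of \<open>moment_series_deriv\<close>, and the squared inverse cancels the
  square of the moment series.\<close>

lemma has_coeff_deriv_F_transform:
  fixes a :: 'a and s :: bool
  assumes F: "admissible \<xi> F"
  defines "\<Lambda> \<equiv> \<lambda>t. moment_series F a (of_real t)"
    and "Q \<equiv> \<lambda>t. fps_X * moment_series (inner (\<not> s)) a (of_real t)"
  shows "has_coeff_deriv (\<lambda>t. F_transform (conv_group F a t))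
    (fps_to_fls ((- generator_series F a oo Q t) + (- generator_series (inner s) a oo Q t) *
       ((inverse (\<Lambda> t))\<^sup>2 * fps_deriv (fps_X * \<Lambda> t) - 1))) t"
proof -
  let ?A = "generator_series F a" and ?C = "generator_series (inner s) a"
  let ?Z = "(?C oo Q t) * fps_deriv (fps_X * \<Lambda> t) + ((?A - ?C) oo Q t) * (\<Lambda> t)\<^sup>2"
  let ?I = "inverse (\<Lambda> t)"
  have I: "?I * \<Lambda> t = 1"
    by (rule inverse_mult_eq_1) (simp add: \<Lambda>_def moment_series_nth_0[OF F])
  have "fps_has_deriv \<Lambda> (Abs_fps (\<lambda>n. poly (pderiv (moment_poly F a n)) (of_real t))) t"
    by (rule fps_has_deriv_poly) (simp add: \<Lambda>_def moment_series_def)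
  then have "fps_has_deriv \<Lambda> (fps_X * ?Z) t"
    unfolding \<Lambda>_def Q_def moment_series_deriv[OF F, of a _ s] .
  then have "fps_has_deriv (\<lambda>t. inverse (\<Lambda> t)) (- ?I\<^sup>2 * (fps_X * ?Z)) t"
    unfolding \<Lambda>_def by (intro fps_has_deriv_inverse) (auto intro: moment_series_nth_0[OF F])
  also have "- ?I\<^sup>2 * (fps_X * ?Z) = fps_X * - (?I\<^sup>2 * ?Z)"
    by (simp add: algebra_simps)
  also have "?I\<^sup>2 * ?Z = (?C oo Q t) * (?I\<^sup>2 * fps_deriv (fps_X * \<Lambda> t)) + ((?A - ?C) oo Q t) * (?I * \<Lambda> t)\<^sup>2"
    by (simp only: power_mult_distrib) (simp add: algebra_simps)
  also have "\<dots> = - ((- ?A oo Q t) + (- ?C oo Q t) * (?I\<^sup>2 * fps_deriv (fps_X * \<Lambda> t) - 1))"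
    unfolding I by (simp add: fps_compose_sub_distrib fps_compose_uminus algebra_simps)
  finally have D: "fps_has_deriv (\<lambda>t. inverse (\<Lambda> t))
      (fps_X * ((- ?A oo Q t) + (- ?C oo Q t) * (?I\<^sup>2 * fps_deriv (fps_X * \<Lambda> t) - 1))) t"
    by (simp only: minus_minus)
  show ?thesis
    unfolding has_coeff_deriv_def F_transform_conv_group[OF F]
  proof
    fix n :: int
    let ?E = "(- ?A oo Q t) + (- ?C oo Q t) * (?I\<^sup>2 * fps_deriv (fps_X * \<Lambda> t) - 1)"
    have "fls_shift 1 (fps_to_fls (fps_X * ?E)) = fps_to_fls ?E"
      by (simp add: fls_times_fps_to_fls fls_X_times_conv_shift del: fps_to_fls_plus)
    then have "fls_nth (fps_to_fls ?E) n = fls_nth (fls_shift 1 (fps_to_fls (fps_X * ?E))) n" by simp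
    also have "\<dots> = (if n + 1 < 0 then 0 else fps_nth (fps_X * ?E) (nat (n + 1)))"
      by simp
    finally have E: "fls_nth (fps_to_fls ?E) n = (if n + 1 < 0 then 0 else fps_nth (fps_X * ?E) (nat (n + 1)))" .
    show "((\<lambda>s. fls_nth (fls_shift 1 (fps_to_fls (inverse (moment_series F a (of_real s))))) n)
        has_vector_derivative fls_nth (fps_to_fls ?E) n) (at t)"
    proof (cases "n + 1 < 0")
      case False
      then have "fls_nth (fls_shift 1 (fps_to_fls f)) n = fps_nth f (nat (n + 1))" for f :: "complex fps"
        by simp
      moreover have "((\<lambda>s. fps_nth (inverse (\<Lambda> s)) (nat (n + 1)))
          has_vector_derivative fps_nth (fps_X * ?E) (nat (n + 1))) (at t)"
        using D unfolding fps_has_deriv_def by blast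
      ultimately show ?thesis
        unfolding E if_not_P[OF False] by (simp only: \<Lambda>_def)
    qed (simp add: E)
  qed
qed

text \<open>At 0 the moment series are 1, so the substitution is the identity and the bracket
  vanishes.\<close>

lemma coeff_deriv_F_transform_0:
  assumes F: "admissible \<xi> F"
  shows "coeff_deriv (\<lambda>t. F_transform (conv_group F a t)) 0 = fps_to_fls (- generator_series F a)"
proof (rule has_coeff_deriv_imp_coeff_deriv)
  have 1: "moment_series F a 0 = 1" "moment_series (inner (\<not> True)) a 0 = 1"
    using moment_series_at_0 F admissible_inner by blast+
  show "has_coeff_deriv (\<lambda>t. F_transform (conv_group F a t)) (fps_to_fls (- generator_series F a)) 0"
    using has_coeff_deriv_F_transform[OF F, of a True 0] unfolding of_real_0 1 by simp
qed

lemma has_coeff_deriv_conv_group: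
  fixes a :: 'a and s :: bool
  assumes F: "admissible \<xi> F"
  defines "F_trans \<equiv> \<lambda>F t. F_transform (conv_group F a t)"
  shows "has_coeff_deriv (F_trans F)
    ((coeff_deriv (F_trans F) 0 \<circ>\<^sub>z F_trans (inner (\<not> s)) t)
      + (coeff_deriv (F_trans (inner s)) 0 \<circ>\<^sub>z F_trans (inner (\<not> s)) t) * (deriv_z (F_trans F t) - 1)) t"
  using has_coeff_deriv_F_transform[OF F, of a s t]
  unfolding F_trans_def coeff_deriv_F_transform_0[OF F] coeff_deriv_F_transform_0[OF admissible_inner]
    compose_z_F_transform[OF admissible_inner] deriv_z_F_transform[OF F]
  by (simp add: fls_times_fps_to_fls)

end

theorem proposition6p2:
  fixes \<phi> \<psi> \<theta> :: "'a::complex_algebra_1 \<Rightarrow> complex"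
    and a :: 'a
    and \<phi>' \<psi>' \<theta>' :: "(nat, 'a) free_product \<Rightarrow> complex"
    and lam mu nu :: "real \<Rightarrow> complex poly \<Rightarrow> complex"
    and F_lam F_mu F_nu :: "real \<Rightarrow> complex fls"
    and A B C :: "complex fls"
    and t :: real
  assumes "three_probability_space \<phi> \<psi> \<theta>"
    and "alpha_free_product (\<lambda>_. \<phi>) (\<lambda>_. \<psi>) (\<lambda>_. \<theta>) \<phi>' \<psi>' \<theta>'"
    and "lam = conv_group \<phi>' a" and "mu = conv_group \<psi>' a" and "nu = conv_group \<theta>' a"
    and "F_lam = (\<lambda>s. F_transform (lam s))"
    and "F_mu = (\<lambda>s. F_transform (mu s))"
    and "F_nu = (\<lambda>s. F_transform (nu s))"
    and "A = coeff_deriv F_lam 0" and "B = coeff_deriv F_mu 0" and "C = coeff_deriv F_nu 0"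
  shows "has_coeff_deriv F_lam
           ((A \<circ>\<^sub>z F_mu t) + (C \<circ>\<^sub>z F_mu t) * (deriv_z (F_lam t) - 1)) t
       \<and> has_coeff_deriv F_lam
           ((A \<circ>\<^sub>z F_nu t) + (B \<circ>\<^sub>z F_nu t) * (deriv_z (F_lam t) - 1)) t
       \<and> ((B \<circ>\<^sub>z F_nu t) - (C \<circ>\<^sub>z F_mu t) \<noteq> 0 \<longrightarrow>
           has_coeff_deriv F_lam
             (((B \<circ>\<^sub>z F_nu t) * (A \<circ>\<^sub>z F_mu t) - (A \<circ>\<^sub>z F_nu t) * (C \<circ>\<^sub>z F_mu t))
               / ((B \<circ>\<^sub>z F_nu t) - (C \<circ>\<^sub>z F_mu t))) t)"
proof -
  interpret alpha_product \<psi> \<theta> \<psi>' \<theta>'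
    using assms(1,2)
    by unfold_locales (auto simp: three_probability_space_def alpha_free_product_def)
  have F: "admissible \<phi> \<phi>'"
    using assms(1,2) by (simp add: admissible_def three_probability_space_def alpha_free_product_def)
  \<comment> \<open>With \<open>s = True\<close> the added copies stand on the left, so
    \<open>inner s\<close> is \<open>\<theta>'\<close> and the other side carries
    \<open>\<psi>'\<close>; \<open>s = False\<close> exchanges the two.\<close>
  have 1: "has_coeff_deriv F_lam ((A \<circ>\<^sub>z F_mu t) + (C \<circ>\<^sub>z F_mu t) * (deriv_z (F_lam t) - 1)) t"
    using has_coeff_deriv_conv_group[OF F, of a True t] unfolding assms(3-) by (simp add: inner_def)
  have 2: "has_coeff_deriv F_lam ((A \<circ>\<^sub>z F_nu t) + (B \<circ>\<^sub>z F_nu t) * (deriv_z (F_lam t) - 1)) t"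
    using has_coeff_deriv_conv_group[OF F, of a False t] unfolding assms(3-) by (simp add: inner_def)
  define D where "D = coeff_deriv F_lam t"
  have D: "D = (A \<circ>\<^sub>z F_mu t) + (C \<circ>\<^sub>z F_mu t) * (deriv_z (F_lam t) - 1)"
    "D = (A \<circ>\<^sub>z F_nu t) + (B \<circ>\<^sub>z F_nu t) * (deriv_z (F_lam t) - 1)"
    unfolding D_def by (rule has_coeff_deriv_imp_coeff_deriv[OF 1] has_coeff_deriv_imp_coeff_deriv[OF 2])+
  \<comment> \<open>The first formula is used in the product with B, the second in the product with
    C; the terms with the bracket then cancel.\<close>
  have "D * ((B \<circ>\<^sub>z F_nu t) - (C \<circ>\<^sub>z F_mu t)) = (B \<circ>\<^sub>z F_nu t) * D - (C \<circ>\<^sub>z F_mu t) * D"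
    by (simp add: algebra_simps)
  also have "\<dots> = (B \<circ>\<^sub>z F_nu t) * (A \<circ>\<^sub>z F_mu t) - (A \<circ>\<^sub>z F_nu t) * (C \<circ>\<^sub>z F_mu t)"
    by (subst D(1), subst D(2)) (simp add: algebra_simps)
  finally have "D = ((B \<circ>\<^sub>z F_nu t) * (A \<circ>\<^sub>z F_mu t) - (A \<circ>\<^sub>z F_nu t) * (C \<circ>\<^sub>z F_mu t))
      / ((B \<circ>\<^sub>z F_nu t) - (C \<circ>\<^sub>z F_mu t))" if "(B \<circ>\<^sub>z F_nu t) - (C \<circ>\<^sub>z F_mu t) \<noteq> 0"
    using that by (simp add: eq_divide_eq)
  then show ?thesis
    using 1 2 unfolding D(1)[symmetric] by metis
qed

end
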